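(* Let $X$ be the maximal random complex over $N$ vertices and let $b_0^E$ be its expected zeroth Betti number, written as a reduced polynomial in the vertex variables $p_i$ and edge variables $p_{ij}$. Then $$b_0^E=\sum_{i=1}^N p_i-\sum_{1\le i<j\le N}p_i\,p_j\,p_{ij}+\sum_{\Gamma}c_1(\Gamma)\,\mathrm{mon}(\Gamma),$$ where $\Gamma$ runs over the graphs on vertices in $\{1,\dots,N\}$ with at least two edges and without isolated vertices that are built by simple cycles having 1-intersections. The coefficients $c_1(\Gamma)$ satisfy $$\sum_{i=0}^{n} c_1(\Gamma^i)=b_1(\Gamma),$$ where $n$ is the number of edges of $\Gamma$. The coefficients in $b_0^E$ of all monomials other than those displayed above are $0$.
   Context: Maximal random complex over $N$ vertices: the random subcomplex of the full simplex on $\{1,\dots,N\}$ in which each vertex $i$ is present independently with probability $p_i$, and each cell $\sigma$ of positive dimension, given that all its proper faces are present, is present with probability $p_\sigma$, independently of everything else (if some face is missing, $\sigma$ is absent). Edge probabilities are written $p_{ij}$. Expected Betti number: $b_0^E=\sum_{\Delta}b_0(\Delta)\,p(\Delta)$, where $\Delta$ runs over all possible realizations (including the empty one, with $b_0=0$) and $p(\Delta)$ is the probability of $\Delta$. Only vertices and edges matter for $b_0$. The reduced polynomial is obtained by fully expanding and collecting terms; it is multilinear in the variables $p_i,p_{ij}$. For a graph $\Gamma$ with vertex set $V(\Gamma)$ and edge set $E(\Gamma)$, $\mathrm{mon}(\Gamma)=\prod_{v\in V(\Gamma)}p_v\prod_{uv\in E(\Gamma)}p_{uv}$. For a graph $\Gamma$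 with $n$ edges, $c_1(\Gamma)=\sum_{S\subseteq E(\Gamma)}(-1)^{|S|}b_1(\Gamma\setminus S)$ if $b_1(\Gamma)\neq 0$, and $c_1(\Gamma)=0$ if $b_1(\Gamma)=0$; here $\Gamma\setminus S$ is $\Gamma$ with the edges in $S$ removed and $b_1$ is the first Betti number of a graph. $\Gamma^i$ is the set of all graphs obtained from $\Gamma$ by removing exactly $i$ edges, and $c_1(\Gamma^i)$ is the sum of $c_1$ over the elements of $\Gamma^i$. A graph is built by simple cycles having 1-intersections if each of its edges lies on a simple cycle of the graph, and any two simple cycles $C,C'$ of the graph can be joined by a finite sequence of simple cycles $C=C_0,C_1,\dots,C_r=C'$ of the graph such that $C_{l}$ and $C_{l+1}$ share at least one edge for each $l$ (a single simple cycle qualifies). *)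

theory Defs
  imports "HOL-Probability.Probability" "HOL-Analysis.Finite_Function_Topology"
begin

subsection \<open>Simplicial complexes and Betti numbers\<close>

text \<open>
  Simplices are nonempty finite sets of natural numbers, oriented by the order of their vertices;
  a complex is the set of its simplices (the empty simplex is not included, the empty complex is
  allowed). Homology is unreduced simplicial homology with real coefficients, and chains are
  finitely supported functions on simplices.
\<close>

definition simplices :: "nat \<Rightarrow> nat set set" where
  "simplices N = {\<sigma>. \<sigma> \<noteq> {} \<and> \<sigma> \<subseteq> {1..N}}"

definition complexes :: "nat \<Rightarrow> nat set set set" where
  "complexes N = {\<Delta>. \<Delta> \<subseteq> simplices N \<and> (\<forall>\<sigma>\<in>\<Delta>. \<forall>\<tau>. \<tau> \<noteq> {} \<and> \<tau> \<subseteq> \<sigma> \<longrightarrow> \<tau> \<in> \<Delta>)}"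

type_synonym chain = "nat set \<Rightarrow>\<^sub>0 real"

definition chains :: "nat \<Rightarrow> nat set set \<Rightarrow> chain set" where
  "chains k \<Delta> = {c. Poly_Mapping.keys c \<subseteq> {\<sigma> \<in> \<Delta>. card \<sigma> = k + 1}}"

text \<open>
  For \<open>\<sigma> = {v\<^sub>0 < \<dots> < v\<^sub>k}\<close> the sign of the face omitting \<open>v = v\<^sub>i\<close> is \<open>(- 1) ^ i\<close>, where \<open>i\<close> counts
  the vertices of \<open>\<sigma>\<close> below \<open>v\<close>. Vertices have boundary zero.
\<close>

definition boundary_simplex :: "nat set \<Rightarrow> chain" where
  "boundary_simplex \<sigma> =
     (\<Sum>v\<in>\<sigma>. if \<sigma> = {v} then 0
             else Poly_Mapping.single (\<sigma> - {v}) ((- 1) ^ card {u \<in> \<sigma>. u < v}))"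

definition boundary :: "chain \<Rightarrow> chain" where
  "boundary c = (\<Sum>\<sigma>\<in>Poly_Mapping.keys c. Poly_Mapping.lookup c \<sigma> *\<^sub>R boundary_simplex \<sigma>)"

definition cycles :: "nat \<Rightarrow> nat set set \<Rightarrow> chain set" where
  "cycles k \<Delta> = {c \<in> chains k \<Delta>. boundary c = 0}"

definition boundaries :: "nat \<Rightarrow> nat set set \<Rightarrow> chain set" where
  "boundaries k \<Delta> = boundary ` chains (k + 1) \<Delta>"

text \<open>
  The dimension of the quotient of cycles by boundaries. For a finite complex both spaces are
  finite-dimensional and boundaries are cycles, so the subtraction on \<^typ>\<open>nat\<close> does not truncate.
\<close>

definition betti :: "nat \<Rightarrow> nat set set \<Rightarrow> nat" where
  "betti k \<Delta> = dim (cycles k \<Delta>) - dim (boundaries k \<Delta>)"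


subsection \<open>The maximal random complex\<close>

text \<open>
  Every simplex \<open>\<sigma>\<close> carries an independent coin with success probability \<open>p \<sigma>\<close>, and \<open>\<sigma>\<close> is present
  iff its coin and the coins of all its faces succeed. Hence, given that all proper faces of \<open>\<sigma>\<close>
  are present, \<open>\<sigma>\<close> is present with probability \<open>p \<sigma>\<close>, independently of everything else. The vertex
  and edge probabilities are \<open>p {i}\<close> and \<open>p {i, j}\<close>.
\<close>

definition max_random_complex :: "nat \<Rightarrow> (nat set \<Rightarrow> real) \<Rightarrow> nat set set pmf" where
  "max_random_complex N p =
     map_pmf (\<lambda>\<omega>. {\<sigma> \<in> simplices N. \<forall>\<tau>. \<tau> \<noteq> {} \<and> \<tau> \<subseteq> \<sigma> \<longrightarrow> \<omega> \<tau>})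
       (Pi_pmf (simplices N) False (\<lambda>\<sigma>. bernoulli_pmf (p \<sigma>)))"


subsection \<open>Polynomials in the face probabilities\<close>

text \<open>
  Elements of the polynomial ring over the reals with one variable per simplex, represented by
  their coefficients on exponent vectors. An element of this type is its own expanded and
  collected form.
\<close>

type_synonym prob_polynomial = "(nat set \<Rightarrow>\<^sub>0 nat) \<Rightarrow>\<^sub>0 real"

definition Var :: "nat set \<Rightarrow> prob_polynomial" where
  "Var \<sigma> = Poly_Mapping.single (Poly_Mapping.single \<sigma> 1) 1"

definition poly_eval :: "(nat set \<Rightarrow> real) \<Rightarrow> prob_polynomial \<Rightarrow> real" where
  "poly_eval p P =
     (\<Sum>m\<in>Poly_Mapping.keys P. Poly_Mapping.lookup P m *
        (\<Prod>\<sigma>\<in>Poly_Mapping.keys m. p \<sigma> ^ Poly_Mapping.lookup m \<sigma>))"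

text \<open>
  The probability of the realization \<open>\<Delta>\<close> as a polynomial: the simplices of \<open>\<Delta>\<close> are present, and
  those simplices outside \<open>\<Delta>\<close> all of whose proper faces are in \<open>\<Delta>\<close> (in particular the missing
  vertices) are absent.
\<close>

definition realization_prob :: "nat \<Rightarrow> nat set set \<Rightarrow> prob_polynomial" where
  "realization_prob N \<Delta> =
     (\<Prod>\<sigma>\<in>\<Delta>. Var \<sigma>) *
     (\<Prod>\<sigma>\<in>{\<sigma> \<in> simplices N - \<Delta>. \<forall>\<tau>. \<tau> \<noteq> {} \<and> \<tau> \<subset> \<sigma> \<longrightarrow> \<tau> \<in> \<Delta>}. 1 - Var \<sigma>)"

definition expected_betti0 :: "nat \<Rightarrow> prob_polynomial" where
  "expected_betti0 N = (\<Sum>\<Delta>\<in>complexes N. of_nat (betti 0 \<Delta>) * realization_prob N \<Delta>)"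


subsection \<open>Graphs\<close>

type_synonym graph = "nat set \<times> nat set set"

abbreviation verts :: "graph \<Rightarrow> nat set" where "verts \<equiv> fst"
abbreviation edges :: "graph \<Rightarrow> nat set set" where "edges \<equiv> snd"

definition graphs_on :: "nat set \<Rightarrow> graph set" where
  "graphs_on A = {\<Gamma>. verts \<Gamma> \<subseteq> A \<and> edges \<Gamma> \<subseteq> {e. e \<subseteq> verts \<Gamma> \<and> card e = 2}}"

definition betti1_graph :: "graph \<Rightarrow> nat" where
  "betti1_graph \<Gamma> = betti 1 ((\<lambda>v. {v}) ` verts \<Gamma> \<union> edges \<Gamma>)"

definition del_edges :: "graph \<Rightarrow> nat set set \<Rightarrow> graph" where
  "del_edges \<Gamma> S = (verts \<Gamma>, edges \<Gamma> - S)"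

definition edge_removals :: "graph \<Rightarrow> nat \<Rightarrow> graph set" where
  "edge_removals \<Gamma> i = {del_edges \<Gamma> S |S. S \<subseteq> edges \<Gamma> \<and> card S = i}"

definition c1 :: "graph \<Rightarrow> int" where
  "c1 \<Gamma> = (if betti1_graph \<Gamma> \<noteq> 0
           then \<Sum>S\<in>Pow (edges \<Gamma>). (- 1) ^ card S * int (betti1_graph (del_edges \<Gamma> S))
           else 0)"

definition mon :: "graph \<Rightarrow> prob_polynomial" where
  "mon \<Gamma> = (\<Prod>v\<in>verts \<Gamma>. Var {v}) * (\<Prod>e\<in>edges \<Gamma>. Var e)"

definition no_isolated_verts :: "graph \<Rightarrow> bool" where
  "no_isolated_verts \<Gamma> \<longleftrightarrow> (\<forall>v\<in>verts \<Gamma>. \<exists>e\<in>edges \<Gamma>. v \<in> e)"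

text \<open>A simple cycle is represented by its edge set.\<close>

definition simple_cycles :: "graph \<Rightarrow> nat set set set" where
  "simple_cycles \<Gamma> =
     {C. C \<subseteq> edges \<Gamma> \<and>
         (\<exists>vs. distinct vs \<and> length vs \<ge> 3 \<and>
               C = {{vs ! i, vs ! (Suc i mod length vs)} |i. i < length vs})}"

definition built_by_cycles_1_intersections :: "graph \<Rightarrow> bool" where
  "built_by_cycles_1_intersections \<Gamma> \<longleftrightarrow>
     (\<forall>e\<in>edges \<Gamma>. \<exists>C\<in>simple_cycles \<Gamma>. e \<in> C) \<and>
     (\<forall>C\<in>simple_cycles \<Gamma>. \<forall>C'\<in>simple_cycles \<Gamma>.
        (C, C') \<in> {(D, D'). D \<in> simple_cycles \<Gamma> \<and> D' \<in> simple_cycles \<Gamma> \<and> D \<inter> D' \<noteq> {}}\<^sup>*)"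

definition cycle_built_graphs :: "nat \<Rightarrow> graph set" where
  "cycle_built_graphs N =
     {\<Gamma> \<in> graphs_on {1..N}. card (edges \<Gamma>) \<ge> 2 \<and> no_isolated_verts \<Gamma> \<and>
        built_by_cycles_1_intersections \<Gamma>}"

end

theory Submission
  imports Defs
begin

text \<open>
  The expansion combines three independent facts.

  Euler characteristic. By rank-nullity for the boundary map on edges, the zeroth Betti number of a
  complex is the number of its vertices, minus the number of its edges, plus the dimension of the
  space of 1-cycles of its 1-skeleton, its cycle rank (lemma \<open>betti_0_eq\<close>). The first two
  terms produce the linear and the edge monomials; everything else comes from the cycle rank.

  Moebius inversion. The number \<open>c1 \<Gamma>\<close> is the Moebius transform of the cycle rank on
  the lattice of edge sets, so the cycle rank of \<open>E\<close> is the sum of the coefficients of all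
  \<open>F \<subseteq> E\<close>. This is already the claimed relation between \<open>c1\<close> and
  \<open>b\<^sub>1\<close>. The Moebius transform of a function vanishes at \<open>F\<close> if the function
  depends only on a proper part of \<open>F\<close>. If \<open>F\<close> is not built by simple cycles having
  1-intersections, then either \<open>F\<close> is a single edge, which has no cycles, or it splits into two
  nonempty parts such that every simple cycle lies in one of them. Since simple cycles span the cycle
  space, the cycle rank is then the sum of the ranks of the two parts (lemma
  \<open>cycle_rank_additive\<close>), and the coefficient of \<open>F\<close> is 0 (lemma
  \<open>moebius_cycle_rank_eq_0\<close>).

  Independence of the coins. The probabilities of the realizations that contain a fixed subcomplex
  \<open>K\<close> add up to the monomial of \<open>K\<close>, as an identity of polynomials (lemma
  \<open>sum_realization_prob_containing\<close>), because \<open>K\<close> is contained in the realization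
  exactly if all coins of \<open>K\<close> succeed.

  The first two facts write \<open>b\<^sub>0(\<Delta>)\<close> as an integer combination of indicators of
  \<open>K \<subseteq> \<Delta>\<close>, with \<open>K\<close> a vertex, an edge with its end points, or a graph
  built by simple cycles (lemma \<open>betti_0_expansion\<close>); the third one replaces each indicator by
  the monomial of \<open>K\<close>.
\<close>

section \<open>Dimensions of chain spaces\<close>

text \<open>
  The space of chains is infinite-dimensional, so the dimension formula is needed for a subspace
  that lies in the span of a finite set, inside an arbitrary real vector space.
\<close>

lemma rank_nullity:
  fixes f :: "'a::real_vector \<Rightarrow> 'b::real_vector"
  assumes lin: "linear f" and V: "subspace V" and fin: "finite W" "V \<subseteq> span W"
  shows "dim V = dim {x \<in> V. f x = 0} + dim (f ` V)"
proof -
  let ?K = "{x \<in> V. f x = 0}"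
  obtain B where B: "B \<subseteq> ?K" "independent B" "?K \<subseteq> span B"
    using real_vector.maximal_independent_subset by blast
  obtain C where C: "B \<subseteq> C" "C \<subseteq> V" "independent C" "V \<subseteq> span C"
    using real_vector.maximal_independent_subset_extend[of B V] B by blast
  have finC: "finite C"
    using real_vector.independent_span_bound[of W C] fin C by (meson order_trans)
  \<comment> \<open>The image has the dimension of a complement of the kernel, which \<open>D\<close> spans.\<close>
  define D where "D = C - B"
  have spanC: "span C = V"
    using C V by (meson real_vector.span_minimal subset_antisym)
  have indD: "independent D"
    using C(3) unfolding D_def by (rule independent_mono) auto
  have "x = 0" if x: "x \<in> span D" "f x = 0" for x
  proof -
    have "x \<in> V" using x spanC span_mono[of D C] D_def by auto
    hence xB: "x \<in> span B" using B x by auto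
    have "representation B x = representation C x"
      using real_vector.representation_extend[OF C(3) xB C(1)] by simp
    moreover have "representation D x = representation C x"
      using real_vector.representation_extend[OF C(3) x(1)] D_def by simp
    ultimately have "representation B x b = 0" for b
      using real_vector.representation_ne_zero[of B x b] real_vector.representation_ne_zero[of D x b]
      unfolding D_def by auto
    thus "x = 0"
      using real_vector.sum_nonzero_representation_eq[OF B(2) xB] by simp
  qed
  hence inj: "inj_on f (span D)"
    using linear_inj_on_iff_eq_0[OF lin subspace_span] by blast
  have "f ` V = span (f ` C)"
    using linear_span_image[OF lin, of C] spanC by simp
  also have "f ` C = f ` B \<union> f ` D"
    unfolding D_def using C(1) by auto
  also have "span (f ` B \<union> f ` D) = span (f ` D)"
  proof
    show "span (f ` B \<union> f ` D) \<subseteq> span (f ` D)"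
      using B(1) by (intro span_minimal) (auto simp: span_base span_zero)
  qed (rule span_mono, simp)
  finally have "dim (f ` V) = card (f ` D)"
    using linear_independent_injective_image[OF lin indD inj]
    by (simp add: real_vector.dim_eq_card_independent)
  also have "\<dots> = card D"
    using inj by (meson card_image inj_on_subset span_superset)
  finally have "dim (f ` V) = card D" .
  moreover have "dim ?K = card B"
    using B by (metis real_vector.dim_unique)
  moreover have "dim V = card C"
    using C by (metis real_vector.dim_unique)
  moreover have "card C = card B + card D"
    using finC C(1) unfolding D_def by (metis card_Diff_subset card_mono finite_subset le_add_diff_inverse)
  ultimately show ?thesis by simp
qed

lemma dim_zero_space: "dim {0 :: 'a::real_vector} = 0"
  using real_vector.dim_unique[of "{}" "{0 :: 'a}" 0] by (simp add: independent_empty)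

lemma lookup_scaleR [simp]:
  "Poly_Mapping.lookup (r *\<^sub>R c) x = r * Poly_Mapping.lookup c x"
  for c :: "'a \<Rightarrow>\<^sub>0 real"
proof -
  have "finite {i. r *\<^sub>R Poly_Mapping.lookup c i \<noteq> 0}"
    by (rule finite_subset[of _ "Poly_Mapping.keys c"]) (auto simp: in_keys_iff)
  thus ?thesis unfolding scaleR_poly_mapping_def by simp
qed

lemma subspace_supported: "subspace {c :: 'a \<Rightarrow>\<^sub>0 real. Poly_Mapping.keys c \<subseteq> S}"
  by (auto simp: subspace_def in_keys_iff lookup_add subset_eq)

lemma poly_mapping_eq_sum_singles:
  fixes P :: "'a \<Rightarrow>\<^sub>0 'b::comm_monoid_add"
  shows "P = (\<Sum>m\<in>Poly_Mapping.keys P. Poly_Mapping.single m (Poly_Mapping.lookup P m))"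
proof (rule poly_mapping_eqI)
  fix y
  show "Poly_Mapping.lookup P y = Poly_Mapping.lookup
      (\<Sum>m\<in>Poly_Mapping.keys P. Poly_Mapping.single m (Poly_Mapping.lookup P m)) y"
    by (simp add: lookup_sum lookup_single when_def in_keys_iff)
qed

lemma supported_subset_span:
  "{c :: 'a \<Rightarrow>\<^sub>0 real. Poly_Mapping.keys c \<subseteq> S} \<subseteq> span ((\<lambda>x. Poly_Mapping.single x 1) ` S)"
proof
  fix c :: "'a \<Rightarrow>\<^sub>0 real" assume c: "c \<in> {c. Poly_Mapping.keys c \<subseteq> S}"
  have single: "Poly_Mapping.single x t = t *\<^sub>R Poly_Mapping.single x 1" for x :: 'a and t :: real
    by (rule poly_mapping_eqI) (simp add: lookup_single when_def)
  have "(\<Sum>x\<in>Poly_Mapping.keys c. Poly_Mapping.single x (Poly_Mapping.lookup c x))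
      \<in> span ((\<lambda>x. Poly_Mapping.single x 1) ` S)"
  proof (rule span_sum)
    fix x assume "x \<in> Poly_Mapping.keys c"
    hence "x \<in> S" using c by blast
    thus "Poly_Mapping.single x (Poly_Mapping.lookup c x) \<in> span ((\<lambda>x. Poly_Mapping.single x 1) ` S)"
      by (subst single) (intro span_scale span_base imageI)
  qed
  thus "c \<in> span ((\<lambda>x. Poly_Mapping.single x 1) ` S)"
    by (subst poly_mapping_eq_sum_singles)
qed

lemma dim_supported:
  assumes S: "finite S"
  shows "dim {c :: 'a \<Rightarrow>\<^sub>0 real. Poly_Mapping.keys c \<subseteq> S} = card S"
proof (rule real_vector.dim_unique)
  let ?s = "\<lambda>x::'a. Poly_Mapping.single x (1::real)"
  have inj: "inj ?s"
    by (rule injI) (metis keys_single singleton_inject zero_neq_one)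
  show "?s ` S \<subseteq> {c. Poly_Mapping.keys c \<subseteq> S}" by auto
  show "{c. Poly_Mapping.keys c \<subseteq> S} \<subseteq> span (?s ` S)" by (rule supported_subset_span)
  show "card (?s ` S) = card S" using inj by (meson card_image inj_on_subset subset_UNIV)
  show "independent (?s ` S)"
  proof (rule real_vector.independent_if_scalars_zero)
    fix f and b assume sum0: "(\<Sum>x\<in>?s ` S. f x *\<^sub>R x) = 0" and b: "b \<in> ?s ` S"
    then obtain y where y: "y \<in> S" "b = ?s y" by auto
    have "0 = Poly_Mapping.lookup (\<Sum>x\<in>S. f (?s x) *\<^sub>R ?s x) y"
      using sum0 inj by (subst (asm) sum.reindex) (auto intro: inj_on_subset)
    also have "\<dots> = (\<Sum>x\<in>S. if x = y then f (?s x) else 0)"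
      by (auto simp: lookup_sum lookup_single when_def intro!: sum.cong)
    also have "\<dots> = f b" using y S by simp
    finally show "f b = 0" by simp
  qed (use S in simp)
qed

section \<open>Betti numbers and the cycle rank\<close>

lemma boundary_eq_sum_superset:
  assumes "finite S" "Poly_Mapping.keys c \<subseteq> S"
  shows "boundary c = (\<Sum>\<sigma>\<in>S. Poly_Mapping.lookup c \<sigma> *\<^sub>R boundary_simplex \<sigma>)"
  unfolding boundary_def using assms
  by (intro sum.mono_neutral_left) (auto simp: in_keys_iff)

lemma linear_boundary: "linear boundary"
proof (rule linearI)
  fix c d :: chain and r :: real
  let ?S = "Poly_Mapping.keys c \<union> Poly_Mapping.keys d"
  have "Poly_Mapping.keys (c + d) \<subseteq> ?S" by (rule Poly_Mapping.keys_add)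
  thus "boundary (c + d) = boundary c + boundary d"
    by (simp add: boundary_eq_sum_superset[of ?S] lookup_add scaleR_add_left sum.distrib)
  have "Poly_Mapping.keys (r *\<^sub>R c) \<subseteq> Poly_Mapping.keys c" by (auto simp: in_keys_iff)
  thus "boundary (r *\<^sub>R c) = r *\<^sub>R boundary c"
    by (simp add: boundary_eq_sum_superset[of "Poly_Mapping.keys c"] scaleR_sum_right)
qed

lemma boundary_single: "boundary (Poly_Mapping.single \<sigma> r) = r *\<^sub>R boundary_simplex \<sigma>"
  by (subst boundary_eq_sum_superset[of "{\<sigma>}"]) auto

lemma boundary_simplex_vertex: "boundary_simplex {v} = 0"
  by (simp add: boundary_simplex_def)

lemma boundary_simplex_edge:
  assumes "a < b"
  shows "boundary_simplex {a, b} = Poly_Mapping.single {b} 1 - Poly_Mapping.single {a} 1"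
proof -
  have below: "{u. (u = a \<or> u = b) \<and> u < a} = {}" "{u. (u = a \<or> u = b) \<and> u < b} = {a}"
    and faces: "{a, b} - {a} = {b}" "{a, b} - {b} = {a}" "{a, b} \<noteq> {a}" "{a, b} \<noteq> {b}"
    using assms by auto
  have "a \<noteq> b" using assms by simp
  thus ?thesis by (simp add: boundary_simplex_def below faces single_uminus del: Collect_empty_eq)
qed

lemma subspace_cycles: "subspace (cycles k \<Delta>)"
proof -
  have "cycles k \<Delta> = {c. Poly_Mapping.keys c \<subseteq> {\<sigma> \<in> \<Delta>. card \<sigma> = k + 1}} \<inter> {c. boundary c = 0}"
    by (auto simp: cycles_def chains_def)
  thus ?thesis
    using subspace_inter[OF subspace_supported linear_subspace_kernel[OF linear_boundary]] by simp
qed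

definition cycle_rank :: "nat set set \<Rightarrow> nat" where
  "cycle_rank E = dim (cycles 1 E)"

lemma card2_iff: "card (e :: nat set) = 2 \<longleftrightarrow> (\<exists>a b. a < b \<and> e = {a, b})"
  unfolding card_2_iff by (metis doubleton_eq_iff insert_commute linorder_neqE_nat nat_neq_iff)

text \<open>
  The Euler characteristic identity. All vertex chains are cycles, and the 0-boundaries are the
  image of the boundary map on edge chains, whose kernel is the cycle space.
\<close>

lemma betti_0_eq:
  assumes fin: "finite \<Delta>"
    and face: "\<And>e v. e \<in> \<Delta> \<Longrightarrow> card e = 2 \<Longrightarrow> v \<in> e \<Longrightarrow> {v} \<in> \<Delta>"
  shows "int (betti 0 \<Delta>) = int (card {\<sigma> \<in> \<Delta>. card \<sigma> = 1}) - int (card {\<sigma> \<in> \<Delta>. card \<sigma> = 2})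
           + int (cycle_rank {\<sigma> \<in> \<Delta>. card \<sigma> = 2})"
proof -
  let ?V = "{\<sigma> \<in> \<Delta>. card \<sigma> = 1}" and ?E = "{\<sigma> \<in> \<Delta>. card \<sigma> = 2}"
  have finVE: "finite ?V" "finite ?E" using fin by auto
  have "boundary c = 0" if "c \<in> chains 0 \<Delta>" for c
    unfolding boundary_def
  proof (rule sum.neutral, rule ballI)
    fix \<sigma> assume "\<sigma> \<in> Poly_Mapping.keys c"
    hence "card \<sigma> = 1" using that by (auto simp: chains_def)
    thus "Poly_Mapping.lookup c \<sigma> *\<^sub>R boundary_simplex \<sigma> = 0"
      by (auto simp: card_1_singleton_iff boundary_simplex_vertex)
  qed
  hence "cycles 0 \<Delta> = chains 0 \<Delta>" by (auto simp: cycles_def)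
  hence cyc: "dim (cycles 0 \<Delta>) = card ?V"
    using dim_supported[OF finVE(1)] by (simp add: chains_def)
  have ch1: "chains 1 \<Delta> = {c. Poly_Mapping.keys c \<subseteq> ?E}"
    by (simp add: chains_def numeral_2_eq_2)
  have "dim (chains 1 \<Delta>) = dim {c \<in> chains 1 \<Delta>. boundary c = 0} + dim (boundary ` chains 1 \<Delta>)"
    unfolding ch1 using finVE(2)
    by (intro rank_nullity[OF linear_boundary subspace_supported _ supported_subset_span]) auto
  moreover have "{c \<in> chains 1 \<Delta>. boundary c = 0} = cycles 1 ?E"
    by (auto simp: cycles_def chains_def numeral_2_eq_2)
  moreover have "dim (chains 1 \<Delta>) = card ?E" unfolding ch1 by (rule dim_supported[OF finVE(2)])
  ultimately have bd: "card ?E = cycle_rank ?E + dim (boundaries 0 \<Delta>)"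
    by (simp add: boundaries_def cycle_rank_def)
  have "boundary c \<in> {d. Poly_Mapping.keys d \<subseteq> ?V}" if "c \<in> chains 1 \<Delta>" for c
    unfolding boundary_def
  proof (rule subspace_sum[OF subspace_supported], rule subspace_scale[OF subspace_supported])
    fix \<sigma> assume "\<sigma> \<in> Poly_Mapping.keys c"
    hence \<sigma>: "\<sigma> \<in> \<Delta>" "card \<sigma> = 2" using that unfolding ch1 by auto
    then obtain a b where ab: "a < b" "\<sigma> = {a, b}" by (auto simp: card2_iff)
    hence "{a} \<in> \<Delta>" "{b} \<in> \<Delta>" using face \<sigma> by auto
    thus "boundary_simplex \<sigma> \<in> {d. Poly_Mapping.keys d \<subseteq> ?V}"
      using keys_diff[of "Poly_Mapping.single {b} (1::real)" "Poly_Mapping.single {a} 1"] ab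
      by (auto simp: boundary_simplex_edge dest!: subsetD)
  qed
  hence "boundaries 0 \<Delta> \<subseteq> {d. Poly_Mapping.keys d \<subseteq> ?V}"
    unfolding boundaries_def add_0 by blast
  also have "\<dots> \<subseteq> span ((\<lambda>x. Poly_Mapping.single x 1) ` ?V)"
    by (rule supported_subset_span)
  finally have "dim (boundaries 0 \<Delta>) \<le> card ((\<lambda>x. Poly_Mapping.single x (1::real)) ` ?V)"
    using finVE(1) by (intro real_vector.dim_le_card) auto
  also have "\<dots> \<le> card ?V" by (rule card_image_le[OF finVE(1)])
  finally show ?thesis using cyc bd by (simp add: betti_def)
qed

text \<open>
  A graph has no triangles that could bound, so its first homology is its cycle space. In
  particular it depends only on the edge set, and isolated vertices do not change it.
\<close>

lemma betti1_graph_eq_cycle_rank: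
  assumes "\<And>e. e \<in> E \<Longrightarrow> card e = 2"
  shows "betti1_graph (V, E) = cycle_rank E"
proof -
  let ?\<Delta> = "(\<lambda>v. {v}) ` V \<union> E"
  have e: "{\<sigma> \<in> ?\<Delta>. card \<sigma> = 2} = {\<sigma> \<in> E. card \<sigma> = 2}" by auto
  hence "cycles 1 ?\<Delta> = cycles 1 E"
    by (simp add: cycles_def chains_def numeral_2_eq_2)
  moreover have no_triangles: "{\<sigma> \<in> ?\<Delta>. card \<sigma> = 2 + 1} = {}" using assms by fastforce
  have "chains 2 ?\<Delta> = {0}"
    unfolding chains_def no_triangles by auto
  hence "boundaries 1 ?\<Delta> = {0}"
    using linear_0[OF linear_boundary] by (simp add: boundaries_def numeral_2_eq_2)
  hence "dim (boundaries 1 ?\<Delta>) = 0"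
    by (simp add: dim_zero_space)
  ultimately show ?thesis by (simp add: betti1_graph_def betti_def cycle_rank_def)
qed

section \<open>Simple cycles span the cycle space\<close>

definition polygon :: "nat list \<Rightarrow> nat set set" where
  "polygon vs = {{vs ! i, vs ! (Suc i mod length vs)} |i. i < length vs}"

lemma mem_simple_cycles_iff:
  "C \<in> simple_cycles \<Gamma> \<longleftrightarrow> C \<subseteq> edges \<Gamma> \<and> (\<exists>vs. distinct vs \<and> length vs \<ge> 3 \<and> C = polygon vs)"
  by (simp add: simple_cycles_def polygon_def)

lemma polygon_edgeI: "Suc i < length vs \<Longrightarrow> {vs ! i, vs ! Suc i} \<in> polygon vs"
  unfolding polygon_def by (intro CollectI exI[of _ i]) simp

lemma simple_cycles_mono: "A \<subseteq> F \<Longrightarrow> C \<in> simple_cycles (V, A) \<Longrightarrow> C \<in> simple_cycles (W, F)"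
  by (auto simp: mem_simple_cycles_iff)

lemma simple_cycle_nonempty:
  assumes "C \<in> simple_cycles \<Gamma>"
  shows "C \<noteq> {}"
proof -
  obtain vs where "length vs \<ge> 3" "C = polygon vs" using assms by (auto simp: mem_simple_cycles_iff)
  thus ?thesis using polygon_edgeI[of 0 vs] by auto
qed

lemma lookup_boundary_simplex_edge:
  assumes "card e = 2"
  shows "Poly_Mapping.lookup (boundary_simplex e) {v} \<noteq> 0 \<longleftrightarrow> v \<in> e"
  using assms by (auto simp: card2_iff boundary_simplex_edge lookup_minus lookup_single when_def)

text \<open>
  A leaf \<open>v\<close> of the support would occur in the boundary with the coefficient of its only
  edge.
\<close>

lemma cycle_no_leaf:
  assumes c: "c \<in> cycles 1 E" and e: "e \<in> Poly_Mapping.keys c" "v \<in> e"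
  obtains e' where "e' \<in> Poly_Mapping.keys c" "e' \<noteq> e" "v \<in> e'"
proof (rule ccontr)
  assume "\<not> thesis"
  hence only: "\<And>e'. e' \<in> Poly_Mapping.keys c \<Longrightarrow> v \<in> e' \<Longrightarrow> e' = e" using that by blast
  have card2: "card e' = 2" if "e' \<in> Poly_Mapping.keys c" for e'
    using c that by (auto simp: cycles_def chains_def)
  have "0 = Poly_Mapping.lookup (boundary c) {v}" using c by (simp add: cycles_def)
  also have "\<dots> = (\<Sum>e'\<in>Poly_Mapping.keys c.
      Poly_Mapping.lookup c e' * Poly_Mapping.lookup (boundary_simplex e') {v})"
    by (simp add: boundary_def lookup_sum)
  also have "\<dots> = (\<Sum>e'\<in>{e}. Poly_Mapping.lookup c e' * Poly_Mapping.lookup (boundary_simplex e') {v})"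
  proof (rule sum.mono_neutral_right)
    show "\<forall>e'\<in>Poly_Mapping.keys c - {e}.
        Poly_Mapping.lookup c e' * Poly_Mapping.lookup (boundary_simplex e') {v} = 0"
    proof
      fix e' assume e': "e' \<in> Poly_Mapping.keys c - {e}"
      hence "v \<notin> e'" using only[of e'] by blast
      thus "Poly_Mapping.lookup c e' * Poly_Mapping.lookup (boundary_simplex e') {v} = 0"
        using lookup_boundary_simplex_edge[of e' v] card2[of e'] e' by simp
    qed
  qed (use e in simp_all)
  finally show False
    using e lookup_boundary_simplex_edge[OF card2[OF e(1)], of v] by (simp add: in_keys_iff)
qed

text \<open>
  Take a longest path in the support. Its first vertex is not a leaf, so it has a second neighbour,
  which must lie on the path by maximality; the chord closes a polygon.
\<close>

lemma support_of_cycle_contains_polygon: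
  assumes c: "c \<in> cycles 1 E" and nz: "c \<noteq> 0"
  obtains vs where "distinct vs" "length vs \<ge> 3" "polygon vs \<subseteq> Poly_Mapping.keys c"
proof -
  let ?K = "Poly_Mapping.keys c"
  have card2: "card e = 2" if "e \<in> ?K" for e
    using c that by (auto simp: cycles_def chains_def)
  \<comment> \<open>Paths with at least one edge; they have boundedly many vertices, so there is a longest one.\<close>
  define path where "path = (\<lambda>vs. distinct vs \<and> length vs \<ge> 2 \<and> set vs \<subseteq> \<Union>?K \<and>
      (\<forall>i. Suc i < length vs \<longrightarrow> {vs ! i, vs ! Suc i} \<in> ?K))"
  have "finite e" if "e \<in> ?K" for e
    using card2[OF that] by (intro card_ge_0_finite) simp
  hence fin: "finite (\<Union>?K)" by (intro finite_Union finite_keys)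
  have bound: "length vs < Suc (card (\<Union>?K))" if "path vs" for vs
    using that card_mono[OF fin, of "set vs"] distinct_card[of vs] by (simp add: path_def)
  have "?K \<noteq> {}" using nz by simp
  then obtain e where e: "e \<in> ?K" by blast
  obtain a b where ab: "a < b" "e = {a, b}" using card2[OF e] unfolding card2_iff by blast
  have "path [a, b]" using e ab unfolding path_def by (auto simp: less_Suc_eq)
  then obtain vs where vs: "path vs" and longest: "\<And>ws. path ws \<Longrightarrow> length ws \<le> length vs"
    using ex_has_greatest_nat[of path "[a, b]" length "Suc (card (\<Union>?K))"] bound by auto
  let ?e = "{vs ! 0, vs ! 1}"
  have "?e \<in> ?K" using vs by (auto simp: path_def)
  then obtain e' where e': "e' \<in> ?K" "e' \<noteq> ?e" "vs ! 0 \<in> e'"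
    using cycle_no_leaf[OF c, of ?e "vs ! 0"] by blast
  obtain u where u: "e' = {vs ! 0, u}" "u \<noteq> vs ! 0"
    using e'(3) card2[OF e'(1)] by (auto simp: card_2_iff)
  have "\<not> path (u # vs)" using longest[of "u # vs"] by auto
  moreover have "{(u # vs) ! i, (u # vs) ! Suc i} \<in> ?K" if "Suc i < length (u # vs)" for i
    using that vs e' u by (cases i) (auto simp: path_def insert_commute)
  ultimately have "u \<in> set vs" using vs e' u by (auto simp: path_def)
  then obtain k where k: "k < length vs" "u = vs ! k" by (auto simp: in_set_conv_nth)
  \<comment> \<open>\<open>u\<close> is neither the start of the path nor the neighbour along \<open>?e\<close>.\<close>
  have "k \<noteq> 0" "k \<noteq> 1" using u e' k by auto
  hence "k \<ge> 2" by simp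
  let ?ws = "take (Suc k) vs"
  have len: "length ?ws = Suc k" using k by simp
  have "{?ws ! i, ?ws ! (Suc i mod length ?ws)} \<in> ?K" if "i < length ?ws" for i
  proof (cases "i = k")
    case True
    thus ?thesis using e' u k len by (simp add: insert_commute)
  next
    case False
    thus ?thesis using that len vs k by (auto simp: path_def)
  qed
  hence "polygon ?ws \<subseteq> ?K" by (auto simp: polygon_def)
  moreover have "distinct ?ws" "length ?ws \<ge> 3" using vs len \<open>k \<ge> 2\<close> by (auto simp: path_def)
  ultimately show ?thesis by (intro that[of ?ws])
qed

text \<open>
  Simplices are oriented by the order of their vertices; the sign makes the edge run from
  \<open>a\<close> to \<open>b\<close> regardless of that order.
\<close>

definition oriented_edge :: "nat \<Rightarrow> nat \<Rightarrow> chain" where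
  "oriented_edge a b = Poly_Mapping.single {a, b} (if a < b then 1 else - 1)"

lemma boundary_oriented_edge:
  assumes "a \<noteq> b"
  shows "boundary (oriented_edge a b) = Poly_Mapping.single {b} 1 - Poly_Mapping.single {a} 1"
proof (cases "a < b")
  case False
  hence "b < a" using assms by simp
  thus ?thesis using boundary_simplex_edge[of b a]
    by (simp add: oriented_edge_def boundary_single insert_commute)
qed (simp add: oriented_edge_def boundary_single boundary_simplex_edge)

definition polygon_chain :: "nat list \<Rightarrow> chain" where
  "polygon_chain vs = (\<Sum>i<length vs. oriented_edge (vs ! i) (vs ! (Suc i mod length vs)))"

lemma Suc_mod_neq: "i < n \<Longrightarrow> 2 \<le> n \<Longrightarrow> Suc i mod n \<noteq> i"
  by (cases "Suc i = n") auto

lemma sum_cyclic_shift: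
  fixes g :: "nat \<Rightarrow> 'a::comm_monoid_add"
  shows "(\<Sum>i<n. g (Suc i mod n)) = (\<Sum>i<n. g i)"
proof (cases n)
  case (Suc m)
  have "(\<Sum>i<n. g (Suc i mod n)) = (\<Sum>i<m. g (Suc i)) + g 0"
    by (simp add: Suc)
  also have "\<dots> = (\<Sum>i<n. g i)"
    by (simp add: Suc sum.lessThan_Suc_shift add.commute del: sum.lessThan_Suc)
  finally show ?thesis .
qed simp

lemma keys_polygon_chain: "Poly_Mapping.keys (polygon_chain vs) \<subseteq> polygon vs"
proof -
  have "Poly_Mapping.keys (polygon_chain vs)
      \<subseteq> (\<Union>i<length vs. Poly_Mapping.keys (oriented_edge (vs ! i) (vs ! (Suc i mod length vs))))"
    unfolding polygon_chain_def by (rule keys_sum)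
  also have "\<dots> \<subseteq> polygon vs"
    by (auto simp: oriented_edge_def polygon_def)
  finally show ?thesis .
qed

lemma card_polygon_edge:
  assumes "distinct vs" "length vs \<ge> 2" "e \<in> polygon vs"
  shows "card e = 2"
proof -
  obtain i where i: "i < length vs" "e = {vs ! i, vs ! (Suc i mod length vs)}"
    using assms by (auto simp: polygon_def)
  have "Suc i mod length vs < length vs" using i by (intro mod_less_divisor) auto
  hence "vs ! i \<noteq> vs ! (Suc i mod length vs)"
    using assms i Suc_mod_neq[of i "length vs"] by (auto simp: nth_eq_iff_index_eq)
  thus ?thesis using i by simp
qed

lemma polygon_chain_cycle:
  assumes vs: "distinct vs" "length vs \<ge> 2" and E: "polygon vs \<subseteq> E"
  shows "polygon_chain vs \<in> cycles 1 E"
proof -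
  let ?n = "length vs" and ?s = "\<lambda>v. Poly_Mapping.single {v} (1::real)"
  have neq: "vs ! i \<noteq> vs ! (Suc i mod ?n)" if "i < ?n" for i
  proof -
    have "Suc i mod ?n < ?n" using that by (intro mod_less_divisor) auto
    thus ?thesis using vs that Suc_mod_neq[of i ?n] by (auto simp: nth_eq_iff_index_eq)
  qed
  have "boundary (polygon_chain vs) = (\<Sum>i<?n. ?s (vs ! (Suc i mod ?n)) - ?s (vs ! i))"
    unfolding polygon_chain_def linear_sum[OF linear_boundary]
    by (intro sum.cong refl boundary_oriented_edge neq) auto
  also have "\<dots> = 0"
    using sum_cyclic_shift[of "\<lambda>i. ?s (vs ! i)" ?n] by (simp add: sum_subtractf)
  finally have "boundary (polygon_chain vs) = 0" .
  thus ?thesis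
    using keys_polygon_chain[of vs] card_polygon_edge[OF vs] E by (auto simp: cycles_def chains_def)
qed

text \<open>
  The condition on the length matters: going back and forth along one edge gives the zero chain.
\<close>

lemma lookup_polygon_chain_first_edge:
  assumes vs: "distinct vs" "length vs \<ge> 3"
  shows "Poly_Mapping.lookup (polygon_chain vs) {vs ! 0, vs ! 1} \<noteq> 0"
proof -
  let ?n = "length vs" and ?e = "{vs ! 0, vs ! 1}"
  have other: "Poly_Mapping.lookup (oriented_edge (vs ! i) (vs ! (Suc i mod ?n))) ?e = 0"
    if i: "i < ?n" "i \<noteq> 0" for i
  proof -
    have "{vs ! i, vs ! (Suc i mod ?n)} \<noteq> ?e"
    proof
      assume eq: "{vs ! i, vs ! (Suc i mod ?n)} = ?e"
      have "0 < ?n" "1 < ?n" using vs by auto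
      moreover from this have "vs ! i \<noteq> vs ! 0" using vs i by (simp add: nth_eq_iff_index_eq)
      ultimately have "vs ! i = vs ! 1" "vs ! (Suc i mod ?n) = vs ! 0" using eq by (auto simp: doubleton_eq_iff)
      moreover have "Suc i mod ?n < ?n" using \<open>0 < ?n\<close> by simp
      ultimately have "i = 1" "Suc i mod ?n = 0"
        using vs i \<open>0 < ?n\<close> \<open>1 < ?n\<close> by (simp_all add: nth_eq_iff_index_eq)
      thus False using vs by simp
    qed
    thus ?thesis by (simp add: oriented_edge_def lookup_single when_def)
  qed
  have "Poly_Mapping.lookup (polygon_chain vs) ?e
      = (\<Sum>i<?n. Poly_Mapping.lookup (oriented_edge (vs ! i) (vs ! (Suc i mod ?n))) ?e)"
    by (simp add: polygon_chain_def lookup_sum)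
  also have "\<dots> = (\<Sum>i\<in>{0}. Poly_Mapping.lookup (oriented_edge (vs ! i) (vs ! (Suc i mod ?n))) ?e)"
    using other vs by (intro sum.mono_neutral_right) auto
  also have "\<dots> \<noteq> 0"
    using vs by (auto simp: oriented_edge_def)
  finally show ?thesis .
qed

text \<open>
  Subtracting from a cycle a suitable multiple of a polygon in its support removes at least one edge
  from the support and adds none, so induction on the size of the support applies.
\<close>

lemma cycles_spanned_by_simple_cycles:
  assumes "c \<in> cycles 1 E"
  shows "c \<in> span {z \<in> cycles 1 E. \<exists>C\<in>simple_cycles (V, E). Poly_Mapping.keys z \<subseteq> C}"
    (is "_ \<in> span ?G")
  using assms
proof (induction "card (Poly_Mapping.keys c)" arbitrary: c rule: less_induct)
  case less
  show ?case
  proof (cases "c = 0")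
    case False
    then obtain vs where vs: "distinct vs" "length vs \<ge> 3" "polygon vs \<subseteq> Poly_Mapping.keys c"
      using support_of_cycle_contains_polygon less.prems by blast
    have keysE: "Poly_Mapping.keys c \<subseteq> E"
      using less.prems by (auto simp: cycles_def chains_def)
    define z where "z = polygon_chain vs"
    let ?e = "{vs ! 0, vs ! 1}"
    \<comment> \<open>The factor is chosen to cancel the coefficient of the edge \<open>?e\<close>.\<close>
    define r where "r = Poly_Mapping.lookup c ?e / Poly_Mapping.lookup z ?e"
    have z: "z \<in> cycles 1 E"
      unfolding z_def using vs keysE by (intro polygon_chain_cycle) auto
    have "polygon vs \<in> simple_cycles (V, E)"
      using vs keysE by (auto simp: mem_simple_cycles_iff)
    hence zG: "z \<in> ?G"
      using z keys_polygon_chain[of vs]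
      by (intro CollectI conjI bexI[of _ "polygon vs"]) (simp_all add: z_def)
    define d where "d = c - r *\<^sub>R z"
    have d: "d \<in> cycles 1 E"
      unfolding d_def using less.prems z
      by (intro subspace_diff subspace_scale subspace_cycles)
    have e: "?e \<in> polygon vs"
      using polygon_edgeI[of 0 vs] vs by simp
    have "?e \<notin> Poly_Mapping.keys d"
      using lookup_polygon_chain_first_edge[OF vs(1,2)]
      by (simp add: d_def r_def z_def in_keys_iff lookup_minus)
    moreover have "Poly_Mapping.keys d \<subseteq> Poly_Mapping.keys c"
    proof -
      have "Poly_Mapping.keys (r *\<^sub>R z) \<subseteq> Poly_Mapping.keys z" by (auto simp: in_keys_iff)
      thus ?thesis
        using keys_polygon_chain[of vs] vs(3) keys_diff[of c "r *\<^sub>R z"] unfolding d_def z_def by blast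
    qed
    ultimately have "card (Poly_Mapping.keys d) < card (Poly_Mapping.keys c)"
      using e vs(3) by (intro psubset_card_mono) auto
    hence "d \<in> span ?G" using less.hyps d by blast
    hence "d + r *\<^sub>R z \<in> span ?G" by (rule span_add) (rule span_scale[OF span_base[OF zG]])
    thus ?thesis by (simp add: d_def)
  qed (simp add: span_zero)
qed

section \<open>Additivity of the cycle rank\<close>

definition restrict_chain :: "nat set set \<Rightarrow> chain \<Rightarrow> chain" where
  "restrict_chain F = Poly_Mapping.mapp (\<lambda>e x. if e \<in> F then x else 0)"

lemma lookup_restrict_chain:
  "Poly_Mapping.lookup (restrict_chain F c) e = (if e \<in> F then Poly_Mapping.lookup c e else 0)"
  by (auto simp: restrict_chain_def lookup_mapp when_def in_keys_iff)

lemma restrict_chain_id: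
  assumes "Poly_Mapping.keys c \<subseteq> F"
  shows "restrict_chain F c = c"
proof (rule poly_mapping_eqI)
  fix e
  show "Poly_Mapping.lookup (restrict_chain F c) e = Poly_Mapping.lookup c e"
    using subsetD[OF assms, of e] by (simp add: lookup_restrict_chain in_keys_iff) blast
qed

lemma linear_restrict_chain: "linear (restrict_chain F)"
  by (rule linearI) (auto intro!: poly_mapping_eqI simp: lookup_restrict_chain lookup_add)

text \<open>
  Restriction of chains to \<open>F2\<close> fixes or kills each chain that is supported on a simple cycle, hence
  maps the cycle space of \<open>A\<close> onto that of \<open>A \<inter> F2\<close>; its kernel consists of the cycles of
  \<open>A \<inter> F1\<close>. The claim is the dimension formula for this map.
\<close>

lemma cycle_rank_additive:
  assumes fin: "finite A" and A: "A \<subseteq> F1 \<union> F2" and disj: "F1 \<inter> F2 = {}"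
    and sep: "\<And>C. C \<in> simple_cycles (V, A) \<Longrightarrow> C \<subseteq> F1 \<or> C \<subseteq> F2"
  shows "cycle_rank A = cycle_rank (A \<inter> F1) + cycle_rank (A \<inter> F2)"
proof -
  let ?r = "restrict_chain F2"
  let ?G = "{z \<in> cycles 1 A. \<exists>C\<in>simple_cycles (V, A). Poly_Mapping.keys z \<subseteq> C}"
  let ?W = "(\<lambda>x. Poly_Mapping.single x (1::real)) ` {e \<in> A. card e = 2}"
  have keysA: "Poly_Mapping.keys c \<subseteq> A" if "c \<in> cycles 1 A" for c
    using that by (auto simp: cycles_def chains_def)
  have "cycles 1 A \<subseteq> span ?W"
    using supported_subset_span[of "{e \<in> A. card e = 2}"]
    by (auto simp: cycles_def chains_def numeral_2_eq_2)
  hence "dim (cycles 1 A) = dim {c \<in> cycles 1 A. ?r c = 0} + dim (?r ` cycles 1 A)"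
    using fin by (intro rank_nullity[OF linear_restrict_chain subspace_cycles, of ?W]) auto
  moreover have "{c \<in> cycles 1 A. ?r c = 0} = cycles 1 (A \<inter> F1)"
  proof -
    have "?r c = 0 \<longleftrightarrow> Poly_Mapping.keys c \<subseteq> F1" if "c \<in> cycles 1 A" for c
      using keysA[OF that] A disj
      by (auto simp: poly_mapping_eq_iff fun_eq_iff lookup_restrict_chain in_keys_iff subset_eq disjoint_iff)
    thus ?thesis by (auto simp: cycles_def chains_def)
  qed
  moreover have "?r ` cycles 1 A = cycles 1 (A \<inter> F2)"
  proof
    have gen: "?r z \<in> cycles 1 (A \<inter> F2)" if z: "z \<in> ?G" for z
    proof -
      obtain C where C: "C \<in> simple_cycles (V, A)" "Poly_Mapping.keys z \<subseteq> C" using z by auto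
      from sep[OF C(1)] show ?thesis
      proof
        assume "C \<subseteq> F1"
        hence "Poly_Mapping.keys z \<inter> F2 = {}" using C disj by blast
        hence "?r z = 0"
          by (auto intro!: poly_mapping_eqI simp: lookup_restrict_chain in_keys_iff disjoint_iff)
        thus ?thesis using subspace_0[OF subspace_cycles] by simp
      next
        assume F2: "C \<subseteq> F2"
        hence "?r z = z" using C by (intro restrict_chain_id) blast
        thus ?thesis using z C F2 by (auto simp: cycles_def chains_def)
      qed
    qed
    have "?r ` cycles 1 A \<subseteq> ?r ` span ?G"
      using cycles_spanned_by_simple_cycles by (intro image_mono) blast
    also have "\<dots> = span (?r ` ?G)"
      by (rule linear_span_image[OF linear_restrict_chain, symmetric])
    also have "\<dots> \<subseteq> cycles 1 (A \<inter> F2)"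
      using gen by (intro span_minimal subspace_cycles) blast
    finally show "?r ` cycles 1 A \<subseteq> cycles 1 (A \<inter> F2)" .
    show "cycles 1 (A \<inter> F2) \<subseteq> ?r ` cycles 1 A"
    proof
      fix c assume c: "c \<in> cycles 1 (A \<inter> F2)"
      hence "Poly_Mapping.keys c \<subseteq> F2" by (auto simp: cycles_def chains_def)
      hence "?r c = c" by (rule restrict_chain_id)
      moreover have "c \<in> cycles 1 A" using c by (auto simp: cycles_def chains_def)
      ultimately show "c \<in> ?r ` cycles 1 A" by (metis image_eqI)
    qed
  qed
  ultimately show ?thesis by (simp add: cycle_rank_def)
qed

lemma cycle_rank_eq_0:
  assumes "simple_cycles (V, A) = {}"
  shows "cycle_rank A = 0"
proof -
  have "cycles 1 A \<subseteq> {0}"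
    using cycles_spanned_by_simple_cycles[of _ A V] assms by auto
  hence "cycles 1 A = {0}" using subspace_0[OF subspace_cycles] by blast
  thus ?thesis
    by (simp add: cycle_rank_def dim_zero_space)
qed

section \<open>Moebius inversion over edge sets\<close>

text \<open>
  The Moebius transform on the lattice of subsets, written as a sum over the removed elements to
  match the definition of \<open>c1\<close>.
\<close>

definition subset_moebius :: "('a set \<Rightarrow> int) \<Rightarrow> 'a set \<Rightarrow> int" where
  "subset_moebius g F = (\<Sum>S\<in>Pow F. (- 1) ^ card S * g (F - S))"

lemma sum_Pow_insert:
  fixes h :: "'a set \<Rightarrow> 'b::comm_monoid_add"
  assumes "finite F" "x \<notin> F"
  shows "(\<Sum>S\<in>Pow (insert x F). h S) = (\<Sum>S\<in>Pow F. h S) + (\<Sum>S\<in>Pow F. h (insert x S))"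
proof -
  have "inj_on (insert x) (Pow F)" using assms(2) by (intro inj_onI) (metis Diff_insert_absorb PowD subsetD)
  moreover have "Pow F \<inter> insert x ` Pow F = {}" using assms by auto
  ultimately show ?thesis
    using assms by (simp add: Pow_insert sum.union_disjoint sum.reindex)
qed

text \<open>
  Inserting an element into the set is a discrete derivative of the function. Both inversion and the
  vanishing of the transform follow from this recursion.
\<close>

lemma subset_moebius_insert:
  assumes "finite F" "x \<notin> F"
  shows "subset_moebius g (insert x F) = subset_moebius (\<lambda>A. g (insert x A)) F - subset_moebius g F"
proof -
  have "subset_moebius g (insert x F)
      = (\<Sum>S\<in>Pow F. (- 1) ^ card S * g (insert x F - S))
      + (\<Sum>S\<in>Pow F. (- 1) ^ card (insert x S) * g (insert x F - insert x S))"
    unfolding subset_moebius_def by (rule sum_Pow_insert[OF assms])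
  also have "(\<Sum>S\<in>Pow F. (- 1) ^ card S * g (insert x F - S)) = subset_moebius (\<lambda>A. g (insert x A)) F"
    unfolding subset_moebius_def using assms(2) by (intro sum.cong refl) (auto simp: insert_Diff_if)
  also have "(\<Sum>S\<in>Pow F. (- 1) ^ card (insert x S) * g (insert x F - insert x S)) = - subset_moebius g F"
    unfolding subset_moebius_def sum_negf[symmetric]
  proof (intro sum.cong refl)
    fix S assume "S \<in> Pow F"
    hence "finite S" "x \<notin> S" "insert x F - insert x S = F - S"
      using assms finite_subset by auto
    thus "(- 1) ^ card (insert x S) * g (insert x F - insert x S) = - ((- 1) ^ card S * g (F - S))"
      by simp
  qed
  finally show ?thesis by simp
qed

lemma subset_moebius_inversion:
  assumes "finite E"
  shows "(\<Sum>F\<in>Pow E. subset_moebius g F) = g E"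
  using assms
proof (induction E arbitrary: g rule: finite_induct)
  case (insert x E)
  have "(\<Sum>F\<in>Pow (insert x E). subset_moebius g F)
      = (\<Sum>F\<in>Pow E. subset_moebius g F) + (\<Sum>F\<in>Pow E. subset_moebius g (insert x F))"
    using insert.hyps by (rule sum_Pow_insert)
  also have "(\<Sum>F\<in>Pow E. subset_moebius g (insert x F))
      = (\<Sum>F\<in>Pow E. subset_moebius (\<lambda>A. g (insert x A)) F - subset_moebius g F)"
    using insert.hyps by (intro sum.cong refl subset_moebius_insert) (auto intro: finite_subset)
  also have "\<dots> = g (insert x E) - g E"
    by (simp add: sum_subtractf insert.IH)
  finally show ?case by (simp add: insert.IH)
qed (simp add: subset_moebius_def)

lemma subset_moebius_cong:
  assumes "\<And>A. A \<subseteq> F \<Longrightarrow> g A = g' A"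
  shows "subset_moebius g F = subset_moebius g' F"
  unfolding subset_moebius_def using assms by (intro sum.cong refl) auto

lemma subset_moebius_add: "subset_moebius (\<lambda>A. g A + g' A) F = subset_moebius g F + subset_moebius g' F"
  by (simp add: subset_moebius_def distrib_left sum.distrib)

text \<open>
  The discrete derivative in the direction of an element outside \<open>D\<close> is zero.
\<close>

lemma subset_moebius_eq_0_if_depends_on_proper_subset:
  assumes fin: "finite F" and proper: "\<not> F \<subseteq> D"
  shows "subset_moebius (\<lambda>A. g (A \<inter> D)) F = 0"
proof -
  obtain x where x: "x \<in> F" "x \<notin> D" using proper by auto
  have "subset_moebius (\<lambda>A. g (A \<inter> D)) (insert x (F - {x})) = 0"
    using fin x by (subst subset_moebius_insert) auto
  thus ?thesis using x by (simp add: insert_absorb)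
qed

section \<open>The coefficients of a graph\<close>

text \<open>
  The cycle rank is a sum of two functions, each of which ignores a nonempty part of \<open>F\<close>.
\<close>

lemma moebius_cycle_rank_eq_0_if_split:
  assumes fin: "finite F" and F: "F \<subseteq> F1 \<union> F2" and disj: "F1 \<inter> F2 = {}"
    and sep: "\<And>C. C \<in> simple_cycles (V, F) \<Longrightarrow> C \<subseteq> F1 \<or> C \<subseteq> F2"
    and proper: "\<not> F \<subseteq> F1" "\<not> F \<subseteq> F2"
  shows "subset_moebius (\<lambda>A. int (cycle_rank A)) F = 0"
proof -
  have "subset_moebius (\<lambda>A. int (cycle_rank A)) F
      = subset_moebius (\<lambda>A. int (cycle_rank (A \<inter> F1)) + int (cycle_rank (A \<inter> F2))) F"
  proof (rule subset_moebius_cong)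
    fix A assume "A \<subseteq> F"
    hence "cycle_rank A = cycle_rank (A \<inter> F1) + cycle_rank (A \<inter> F2)"
      using fin F disj sep simple_cycles_mono[of A F _ V V] finite_subset[of A F]
      by (intro cycle_rank_additive[where V = V]) blast+
    thus "int (cycle_rank A) = int (cycle_rank (A \<inter> F1)) + int (cycle_rank (A \<inter> F2))" by simp
  qed
  also have "\<dots> = 0"
    using subset_moebius_eq_0_if_depends_on_proper_subset[OF fin proper(1), of "\<lambda>A. int (cycle_rank A)"]
      subset_moebius_eq_0_if_depends_on_proper_subset[OF fin proper(2), of "\<lambda>A. int (cycle_rank A)"]
    by (simp add: subset_moebius_add)
  finally show ?thesis .
qed

text \<open>
  There are two ways to fail the condition. An edge on no simple cycle can be split off, or else is
  all of \<open>F\<close>, and then there are no cycles at all. If every edge lies on a simple cycle, there are two simple cycles that no chain of intersecting cycles joins; the edges of the cycles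
  reachable from the first one then separate the simple cycles.
\<close>

lemma moebius_cycle_rank_eq_0:
  assumes fin: "finite F" and notbuilt: "\<not> built_by_cycles_1_intersections (V, F)"
  shows "subset_moebius (\<lambda>A. int (cycle_rank A)) F = 0"
proof (cases "\<forall>e\<in>F. \<exists>C\<in>simple_cycles (V, F). e \<in> C")
  case False
  then obtain e where e: "e \<in> F" "\<And>C. C \<in> simple_cycles (V, F) \<Longrightarrow> e \<notin> C" by auto
  have cycles_avoid: "C \<subseteq> F - {e}" if "C \<in> simple_cycles (V, F)" for C
    using e(2) that by (auto simp: mem_simple_cycles_iff)
  show ?thesis
  proof (cases "F = {e}")
    case False
    thus ?thesis
      using e cycles_avoid
      by (intro moebius_cycle_rank_eq_0_if_split[OF fin, of "F - {e}" "{e}" V]) auto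
  next
    case True
    have "simple_cycles (V, A) = {}" if "A \<subseteq> F" for A
    proof (rule ccontr)
      assume "simple_cycles (V, A) \<noteq> {}"
      then obtain C where "C \<in> simple_cycles (V, A)" by blast
      hence C: "C \<in> simple_cycles (V, F)" using that simple_cycles_mono by blast
      hence "C \<subseteq> {}" using cycles_avoid[OF C] True by simp
      thus False using simple_cycle_nonempty[OF C] by simp
    qed
    hence "subset_moebius (\<lambda>A. int (cycle_rank A)) F = subset_moebius (\<lambda>A. 0) F"
      by (intro subset_moebius_cong) (simp add: cycle_rank_eq_0[where V = V])
    thus ?thesis by (simp add: subset_moebius_def)
  qed
next
  case True
  let ?R = "{(D, D'). D \<in> simple_cycles (V, F) \<and> D' \<in> simple_cycles (V, F) \<and> D \<inter> D' \<noteq> {}}"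
  obtain C0 C1 where C01: "C0 \<in> simple_cycles (V, F)" "C1 \<in> simple_cycles (V, F)" "(C0, C1) \<notin> ?R\<^sup>*"
    using notbuilt True unfolding built_by_cycles_1_intersections_def by auto
  \<comment> \<open>A simple cycle that meets \<open>F1\<close> is itself reachable from \<open>C0\<close>.\<close>
  define F1 where "F1 = \<Union>{C \<in> simple_cycles (V, F). (C0, C) \<in> ?R\<^sup>*}"
  have meets: "(C0, C) \<in> ?R\<^sup>*" if "C \<in> simple_cycles (V, F)" "C \<inter> F1 \<noteq> {}" for C
  proof -
    obtain D where D: "D \<in> simple_cycles (V, F)" "(C0, D) \<in> ?R\<^sup>*" "C \<inter> D \<noteq> {}"
      using \<open>C \<inter> F1 \<noteq> {}\<close> by (auto simp: F1_def)
    hence "(D, C) \<in> ?R" using that by auto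
    thus ?thesis using D by (meson rtrancl.rtrancl_into_rtrancl)
  qed
  have nonempty: "C \<noteq> {}" "C \<subseteq> F" if "C \<in> simple_cycles (V, F)" for C
    using that simple_cycle_nonempty[OF that] by (auto simp: mem_simple_cycles_iff)
  have "C0 \<subseteq> F1" using C01 by (auto simp: F1_def)
  moreover have "C1 \<inter> F1 = {}" using C01 meets by blast
  moreover have "C \<subseteq> F1 \<or> C \<subseteq> F - F1" if "C \<in> simple_cycles (V, F)" for C
  proof (cases "C \<inter> F1 = {}")
    case False
    thus ?thesis using meets that by (auto simp: F1_def)
  qed (use nonempty[OF that] in auto)
  ultimately show ?thesis
    using nonempty[OF C01(1)] nonempty[OF C01(2)]
    by (intro moebius_cycle_rank_eq_0_if_split[OF fin, of F1 "F - F1" V]) auto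
qed

text \<open>
  Removing edges cannot create cycles. So in the case \<open>b\<^sub>1 = 0\<close> of the definition of
  \<open>c1\<close> the Moebius transform of the cycle rank is 0 as well.
\<close>

lemma cycle_rank_eq_0_subset:
  assumes "cycle_rank E = 0" "finite E" "F \<subseteq> E"
  shows "cycle_rank F = 0"
proof -
  let ?W = "(\<lambda>x. Poly_Mapping.single x (1::real)) ` E"
  have E: "cycles 1 E \<subseteq> span ?W"
    using supported_subset_span[of E] by (auto simp: cycles_def chains_def)
  obtain B where B: "B \<subseteq> cycles 1 E" "independent B" "cycles 1 E \<subseteq> span B" "card B = dim (cycles 1 E)"
    using real_vector.basis_exists by blast
  have "finite B"
    using real_vector.independent_span_bound[of ?W B] B E \<open>finite E\<close> by (auto intro: order_trans)
  hence "cycles 1 E \<subseteq> {0}"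
    using B assms(1) by (simp add: cycle_rank_def)
  moreover have "cycles 1 F \<subseteq> cycles 1 E" using assms(3) by (auto simp: cycles_def chains_def)
  ultimately have "cycles 1 F = {0}" using subspace_0[OF subspace_cycles] by blast
  thus ?thesis
    by (simp add: cycle_rank_def dim_zero_space)
qed

lemma c1_eq_moebius:
  assumes fin: "finite E" and E: "\<And>e. e \<in> E \<Longrightarrow> card e = 2"
  shows "c1 (V, E) = subset_moebius (\<lambda>A. int (cycle_rank A)) E"
proof -
  have b1: "betti1_graph (V, A) = cycle_rank A" if "A \<subseteq> E" for A
    using that E by (intro betti1_graph_eq_cycle_rank) auto
  show ?thesis
  proof (cases "cycle_rank E = 0")
    case True
    hence "subset_moebius (\<lambda>A. int (cycle_rank A)) E = subset_moebius (\<lambda>A. 0) E"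
      using fin by (intro subset_moebius_cong) (simp add: cycle_rank_eq_0_subset)
    thus ?thesis using True b1 by (simp add: c1_def subset_moebius_def)
  next
    case False
    thus ?thesis
      using b1 by (auto simp: c1_def del_edges_def subset_moebius_def intro!: sum.cong)
  qed
qed

text \<open>
  Grouped by the number of removed edges, this is Moebius inversion at the edge set of the graph.
\<close>

lemma sum_c1_edge_removals:
  assumes "\<Gamma> \<in> graphs_on A" "finite A"
  shows "(\<Sum>i=0..card (edges \<Gamma>). \<Sum>\<Gamma>'\<in>edge_removals \<Gamma> i. c1 \<Gamma>') = int (betti1_graph \<Gamma>)"
proof -
  obtain V E where \<Gamma>: "\<Gamma> = (V, E)" by (cases \<Gamma>)
  have V: "finite V" and E: "\<And>e. e \<in> E \<Longrightarrow> e \<subseteq> V \<and> card e = 2"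
    using assms finite_subset by (auto simp: graphs_on_def \<Gamma>)
  have fin: "finite E"
    using E by (intro finite_subset[of E "Pow V"]) (auto simp: V)
  have coeff: "c1 (del_edges \<Gamma> S) = subset_moebius (\<lambda>A. int (cycle_rank A)) (E - S)" for S
    using c1_eq_moebius[of "E - S" V] E fin by (simp add: del_edges_def \<Gamma>)
  have "(\<Sum>i=0..card (edges \<Gamma>). \<Sum>\<Gamma>'\<in>edge_removals \<Gamma> i. c1 \<Gamma>')
      = (\<Sum>i=0..card E. \<Sum>S\<in>{S \<in> Pow E. card S = i}. c1 (del_edges \<Gamma> S))"
  proof (intro sum.cong)
    fix i
    have "inj_on (del_edges \<Gamma>) {S \<in> Pow E. card S = i}"
      by (rule inj_onI) (auto simp: del_edges_def \<Gamma>)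
    moreover have "edge_removals \<Gamma> i = del_edges \<Gamma> ` {S \<in> Pow E. card S = i}"
      by (auto simp: edge_removals_def \<Gamma>)
    ultimately show "(\<Sum>\<Gamma>'\<in>edge_removals \<Gamma> i. c1 \<Gamma>') = (\<Sum>S\<in>{S \<in> Pow E. card S = i}. c1 (del_edges \<Gamma> S))"
      by (simp add: sum.reindex)
  qed (simp add: \<Gamma>)
  also have "\<dots> = (\<Sum>S\<in>Pow E. c1 (del_edges \<Gamma> S))"
    using fin by (intro sum.group) (auto intro: card_mono)
  also have "\<dots> = (\<Sum>F\<in>Pow E. subset_moebius (\<lambda>A. int (cycle_rank A)) F)"
    unfolding coeff
    by (rule sum.reindex_bij_witness[of _ "\<lambda>F. E - F" "\<lambda>S. E - S"]) auto
  also have "\<dots> = int (betti1_graph \<Gamma>)"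
    using subset_moebius_inversion[OF fin] betti1_graph_eq_cycle_rank E by (simp add: \<Gamma>)
  finally show ?thesis .
qed

lemma finite_graphs_on:
  assumes "finite A"
  shows "finite (graphs_on A)"
proof (rule finite_subset)
  show "graphs_on A \<subseteq> Pow A \<times> Pow (Pow A)" by (auto simp: graphs_on_def) blast
qed (use assms in simp)

text \<open>
  Moebius inversion, restricted to the edge sets whose coefficient can be nonzero. An edge set
  corresponds to a unique graph without isolated vertices, whose vertices are the end points of the
  edges. An edge set that meets the cycle condition and has fewer than two edges is empty, as a
  simple cycle has at least two distinct edges; the empty edge set has coefficient 0.
\<close>

lemma cycle_rank_eq_sum_cycle_built:
  assumes E: "\<And>e. e \<in> E \<Longrightarrow> e \<subseteq> {1..N} \<and> card e = 2"
  shows "int (cycle_rank E) = (\<Sum>\<Gamma>\<in>cycle_built_graphs N. if edges \<Gamma> \<subseteq> E then c1 \<Gamma> else 0)"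
proof -
  have fin: "finite E"
    using E by (intro finite_subset[of E "Pow {1..N}"]) auto
  let ?m = "subset_moebius (\<lambda>A. int (cycle_rank A))"
  let ?B = "{\<Gamma> \<in> cycle_built_graphs N. edges \<Gamma> \<subseteq> E}"
  have verts_eq: "verts \<Gamma> = \<Union>(edges \<Gamma>)" if "\<Gamma> \<in> cycle_built_graphs N" for \<Gamma>
    using that by (fastforce simp: cycle_built_graphs_def no_isolated_verts_def graphs_on_def)
  have "int (cycle_rank E) = (\<Sum>F\<in>Pow E. ?m F)"
    by (rule subset_moebius_inversion[OF fin, symmetric])
  also have "\<dots> = (\<Sum>F\<in>edges ` ?B. ?m F)"
  proof (rule sum.mono_neutral_right)
    show "\<forall>F\<in>Pow E - edges ` ?B. ?m F = 0"
    proof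
      fix F assume F: "F \<in> Pow E - edges ` ?B"
      hence finF: "finite F" using fin finite_subset by auto
      have "(\<Union>F, F) \<in> graphs_on {1..N}" using F E by (force simp: graphs_on_def)
      moreover have "no_isolated_verts (\<Union>F, F)" by (auto simp: no_isolated_verts_def)
      moreover have "(\<Union>F, F) \<notin> cycle_built_graphs N"
      proof
        assume "(\<Union>F, F) \<in> cycle_built_graphs N"
        hence "(\<Union>F, F) \<in> ?B" using F by auto
        hence "F \<in> edges ` ?B" by (intro rev_image_eqI[of "(\<Union>F, F)"]) simp_all
        thus False using F by simp
      qed
      ultimately have "card F < 2 \<or> \<not> built_by_cycles_1_intersections (\<Union>F, F)"
        by (auto simp: cycle_built_graphs_def)
      moreover have "F = {}" if small: "card F < 2" and built: "built_by_cycles_1_intersections (\<Union>F, F)"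
      proof (rule ccontr)
        assume "F \<noteq> {}"
        then obtain e where "e \<in> F" by blast
        then obtain C where "C \<in> simple_cycles (\<Union>F, F)"
          using built unfolding built_by_cycles_1_intersections_def by force
        then obtain vs where vs: "distinct vs" "length vs \<ge> 3" "polygon vs \<subseteq> F"
          by (auto simp: mem_simple_cycles_iff)
        have "{vs ! 0, vs ! 1} \<in> polygon vs" "{vs ! 1, vs ! 2} \<in> polygon vs"
          using vs(2) polygon_edgeI[of 0 vs] polygon_edgeI[of 1 vs] by (simp_all add: numeral_2_eq_2)
        moreover have "{vs ! 0, vs ! 1} \<noteq> {vs ! 1, vs ! 2}"
        proof -
          have "0 < length vs" "1 < length vs" "2 < length vs" using vs(2) by auto
          thus ?thesis using vs(1) by (auto simp: doubleton_eq_iff nth_eq_iff_index_eq)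
        qed
        ultimately have "card {{vs ! 0, vs ! 1}, {vs ! 1, vs ! 2}} \<le> card F"
          using vs(3) by (intro card_mono finF) auto
        thus False using small \<open>{vs ! 0, vs ! 1} \<noteq> {vs ! 1, vs ! 2}\<close> by simp
      qed
      moreover have "simple_cycles (\<Union>F, {}) = {}"
        using simple_cycle_nonempty[of _ "(\<Union>F, {})"] unfolding simple_cycles_def by fastforce
      hence "?m {} = 0" by (simp add: subset_moebius_def cycle_rank_eq_0[of "\<Union>F"])
      ultimately show "?m F = 0" using moebius_cycle_rank_eq_0[OF finF, of "\<Union>F"] by auto
    qed
  qed (use fin in auto)
  also have "\<dots> = (\<Sum>\<Gamma>\<in>?B. ?m (edges \<Gamma>))"
  proof -
    have "inj_on edges ?B"
    proof (rule inj_onI)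
      fix \<Gamma> \<Gamma>' assume "\<Gamma> \<in> ?B" "\<Gamma>' \<in> ?B" "edges \<Gamma> = edges \<Gamma>'"
      thus "\<Gamma> = \<Gamma>'"
        using verts_eq[of \<Gamma>] verts_eq[of \<Gamma>']
        by (simp add: prod_eq_iff)
    qed
    thus ?thesis by (simp add: sum.reindex)
  qed
  also have "\<dots> = (\<Sum>\<Gamma>\<in>?B. c1 \<Gamma>)"
  proof (intro sum.cong refl)
    fix \<Gamma> assume "\<Gamma> \<in> ?B"
    hence sub: "edges \<Gamma> \<subseteq> E" by simp
    have "c1 (verts \<Gamma>, edges \<Gamma>) = ?m (edges \<Gamma>)"
      using E sub by (intro c1_eq_moebius finite_subset[OF sub fin]) blast
    thus "?m (edges \<Gamma>) = c1 \<Gamma>" by simp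
  qed
  also have "\<dots> = (\<Sum>\<Gamma>\<in>cycle_built_graphs N. if edges \<Gamma> \<subseteq> E then c1 \<Gamma> else 0)"
    using finite_graphs_on[of "{1..N}"]
    by (intro sum.inter_filter) (simp add: cycle_built_graphs_def)
  finally show ?thesis .
qed

section \<open>Evaluation of polynomials\<close>

definition monomial_value :: "(nat set \<Rightarrow> real) \<Rightarrow> (nat set \<Rightarrow>\<^sub>0 nat) \<Rightarrow> real" where
  "monomial_value p m = (\<Prod>\<sigma>\<in>Poly_Mapping.keys m. p \<sigma> ^ Poly_Mapping.lookup m \<sigma>)"

lemma monomial_value_superset:
  assumes "finite S" "Poly_Mapping.keys m \<subseteq> S"
  shows "monomial_value p m = (\<Prod>\<sigma>\<in>S. p \<sigma> ^ Poly_Mapping.lookup m \<sigma>)"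
  unfolding monomial_value_def using assms
  by (intro prod.mono_neutral_left) (auto simp: in_keys_iff)

lemma monomial_value_add: "monomial_value p (m + n) = monomial_value p m * monomial_value p n"
proof -
  let ?S = "Poly_Mapping.keys m \<union> Poly_Mapping.keys n"
  have "Poly_Mapping.keys (m + n) \<subseteq> ?S" by (rule Poly_Mapping.keys_add)
  thus ?thesis
    by (simp add: monomial_value_superset[of ?S] lookup_add power_add prod.distrib)
qed

lemma poly_eval_superset:
  assumes "finite S" "Poly_Mapping.keys P \<subseteq> S"
  shows "poly_eval p P = (\<Sum>m\<in>S. Poly_Mapping.lookup P m * monomial_value p m)"
  unfolding poly_eval_def monomial_value_def[symmetric] using assms
  by (intro sum.mono_neutral_left) (auto simp: in_keys_iff)

lemma poly_eval_single: "poly_eval p (Poly_Mapping.single m a) = a * monomial_value p m"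
  by (subst poly_eval_superset[of "{m}"]) auto

lemma poly_eval_add: "poly_eval p (P + Q) = poly_eval p P + poly_eval p Q"
proof -
  let ?S = "Poly_Mapping.keys P \<union> Poly_Mapping.keys Q"
  have "Poly_Mapping.keys (P + Q) \<subseteq> ?S" by (rule Poly_Mapping.keys_add)
  thus ?thesis
    by (simp add: poly_eval_superset[of ?S] lookup_add distrib_right sum.distrib)
qed

lemma poly_eval_0: "poly_eval p 0 = 0"
  by (simp add: poly_eval_def)

lemma poly_eval_sum: "poly_eval p (\<Sum>i\<in>I. P i) = (\<Sum>i\<in>I. poly_eval p (P i))"
  by (induction I rule: infinite_finite_induct) (auto simp: poly_eval_0 poly_eval_add)

lemma poly_eval_1: "poly_eval p 1 = 1"
  using poly_eval_single[of p 0 1] by (simp add: monomial_value_def)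

lemma poly_eval_diff: "poly_eval p (P - Q) = poly_eval p P - poly_eval p Q"
  using poly_eval_add[of p "P - Q" Q] by simp

lemma poly_eval_of_nat: "poly_eval p (of_nat n) = of_nat n"
  by (induction n) (auto simp: poly_eval_0 poly_eval_1 poly_eval_add)

text \<open>
  By bilinearity it suffices to multiply single monomials, whose exponents add. As evaluation is also
  additive, it turns the polynomial of a realization into the actual probability.
\<close>

lemma poly_eval_mult: "poly_eval p (P * Q) = poly_eval p P * poly_eval p Q"
proof -
  let ?K = Poly_Mapping.keys and ?l = Poly_Mapping.lookup
  have "P * Q = (\<Sum>m\<in>?K P. \<Sum>n\<in>?K Q. Poly_Mapping.single (m + n) (?l P m * ?l Q n))"
    by (subst (1) poly_mapping_eq_sum_singles[of P], subst (1) poly_mapping_eq_sum_singles[of Q])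
      (simp add: sum_product mult_single)
  hence "poly_eval p (P * Q)
      = (\<Sum>m\<in>?K P. \<Sum>n\<in>?K Q. (?l P m * monomial_value p m) * (?l Q n * monomial_value p n))"
    by (simp add: poly_eval_sum poly_eval_single monomial_value_add mult_ac)
  also have "\<dots> = poly_eval p P * poly_eval p Q"
    by (simp add: sum_product poly_eval_superset[of "?K P" P] poly_eval_superset[of "?K Q" Q])
  finally show ?thesis .
qed

lemma poly_eval_prod: "poly_eval p (\<Prod>i\<in>I. P i) = (\<Prod>i\<in>I. poly_eval p (P i))"
  by (induction I rule: infinite_finite_induct) (auto simp: poly_eval_1 poly_eval_mult)

lemma poly_eval_Var: "poly_eval p (Var \<sigma>) = p \<sigma>"
  by (simp add: Var_def poly_eval_single monomial_value_def)

section \<open>Realizations as cylinder events\<close>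

text \<open>
  The probability that exactly the coins in \<open>\<omega>\<close> succeed, in an arbitrary commutative
  ring of probabilities.
\<close>

definition coin_weight :: "'a set \<Rightarrow> ('a \<Rightarrow> 'b::comm_ring_1) \<Rightarrow> 'a set \<Rightarrow> 'b" where
  "coin_weight S x \<omega> = (\<Prod>\<sigma>\<in>\<omega>. x \<sigma>) * (\<Prod>\<sigma>\<in>S - \<omega>. 1 - x \<sigma>)"

text \<open>
  The event prescribes success on \<open>A\<close> and failure on \<open>B\<close>; each remaining coin
  contributes the factor \<open>x \<sigma> + (1 - x \<sigma>) = 1\<close>.
\<close>

lemma sum_coin_weight_cylinder:
  assumes fin: "finite S" and sub: "A \<subseteq> S" "B \<subseteq> S" "A \<inter> B = {}"
  shows "(\<Sum>\<omega>\<in>{\<omega> \<in> Pow S. A \<subseteq> \<omega> \<and> \<omega> \<inter> B = {}}. coin_weight S x \<omega>)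
       = (\<Prod>\<sigma>\<in>A. x \<sigma>) * (\<Prod>\<sigma>\<in>B. 1 - x \<sigma>)"
proof -
  \<comment> \<open>The zeros make all terms outside the event vanish in the expansion of the product of sums.\<close>
  let ?f = "\<lambda>\<sigma>. if \<sigma> \<in> B then 0 else x \<sigma>" and ?g = "\<lambda>\<sigma>. if \<sigma> \<in> A then 0 else 1 - x \<sigma>"
  have "(\<Sum>\<omega>\<in>{\<omega> \<in> Pow S. A \<subseteq> \<omega> \<and> \<omega> \<inter> B = {}}. coin_weight S x \<omega>)
      = (\<Sum>\<omega>\<in>Pow S. (\<Prod>\<sigma>\<in>\<omega>. ?f \<sigma>) * (\<Prod>\<sigma>\<in>S - \<omega>. ?g \<sigma>))"
  proof (rule sum.mono_neutral_cong_left)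
    fix \<omega> assume "\<omega> \<in> {\<omega> \<in> Pow S. A \<subseteq> \<omega> \<and> \<omega> \<inter> B = {}}"
    thus "coin_weight S x \<omega> = (\<Prod>\<sigma>\<in>\<omega>. ?f \<sigma>) * (\<Prod>\<sigma>\<in>S - \<omega>. ?g \<sigma>)"
      unfolding coin_weight_def by (intro arg_cong2[of _ _ _ _ "(*)"] prod.cong) auto
  next
    show "\<forall>\<omega>\<in>Pow S - {\<omega> \<in> Pow S. A \<subseteq> \<omega> \<and> \<omega> \<inter> B = {}}.
        (\<Prod>\<sigma>\<in>\<omega>. ?f \<sigma>) * (\<Prod>\<sigma>\<in>S - \<omega>. ?g \<sigma>) = 0"
    proof
      fix \<omega> assume \<omega>: "\<omega> \<in> Pow S - {\<omega> \<in> Pow S. A \<subseteq> \<omega> \<and> \<omega> \<inter> B = {}}"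
      hence finw: "finite \<omega>" "finite (S - \<omega>)" using fin finite_subset by auto
      from \<omega> consider \<sigma> where "\<sigma> \<in> A" "\<sigma> \<notin> \<omega>" | \<sigma> where "\<sigma> \<in> \<omega>" "\<sigma> \<in> B" by auto
      thus "(\<Prod>\<sigma>\<in>\<omega>. ?f \<sigma>) * (\<Prod>\<sigma>\<in>S - \<omega>. ?g \<sigma>) = 0"
      proof cases
        case 1
        hence "(\<Prod>\<sigma>\<in>S - \<omega>. ?g \<sigma>) = 0" using finw sub by (intro prod_zero) auto
        thus ?thesis by simp
      next
        case 2
        hence "(\<Prod>\<sigma>\<in>\<omega>. ?f \<sigma>) = 0" using finw by (intro prod_zero) auto
        thus ?thesis by simp
      qed
    qed
  qed (use fin in auto)
  also have "\<dots> = (\<Prod>\<sigma>\<in>S. ?f \<sigma> + ?g \<sigma>)"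
    by (rule prod_add[OF fin, symmetric])
  also have "\<dots> = (\<Prod>\<sigma>\<in>A \<union> B. if \<sigma> \<in> A then x \<sigma> else 1 - x \<sigma>)"
    using fin sub by (intro prod.mono_neutral_cong_right) auto
  also have "\<dots> = (\<Prod>\<sigma>\<in>A. if \<sigma> \<in> A then x \<sigma> else 1 - x \<sigma>) * (\<Prod>\<sigma>\<in>B. if \<sigma> \<in> A then x \<sigma> else 1 - x \<sigma>)"
    using fin sub finite_subset by (intro prod.union_disjoint) auto
  also have "\<dots> = (\<Prod>\<sigma>\<in>A. x \<sigma>) * (\<Prod>\<sigma>\<in>B. 1 - x \<sigma>)"
    using sub by (intro arg_cong2[of _ _ _ _ "(*)"] prod.cong) auto
  finally show ?thesis .
qed

definition realize :: "nat \<Rightarrow> nat set set \<Rightarrow> nat set set" where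
  "realize N \<omega> = {\<sigma> \<in> simplices N. \<forall>\<tau>. \<tau> \<noteq> {} \<and> \<tau> \<subseteq> \<sigma> \<longrightarrow> \<tau> \<in> \<omega>}"

text \<open>
  The simplices whose absence from \<open>\<Delta>\<close> is decided by their own coin, and so the index
  set of the second product in \<open>realization_prob\<close>.
\<close>

definition minimal_nonfaces :: "nat \<Rightarrow> nat set set \<Rightarrow> nat set set" where
  "minimal_nonfaces N \<Delta> = {\<sigma> \<in> simplices N - \<Delta>. \<forall>\<tau>. \<tau> \<noteq> {} \<and> \<tau> \<subset> \<sigma> \<longrightarrow> \<tau> \<in> \<Delta>}"

lemma finite_simplices: "finite (simplices N)"
  by (rule finite_subset[of _ "Pow {1..N}"]) (auto simp: simplices_def)

lemma finite_complexes: "finite (complexes N)"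
  by (rule finite_subset[of _ "Pow (simplices N)"]) (auto simp: complexes_def finite_simplices)

lemma realize_in_complexes: "realize N \<omega> \<in> complexes N"
  unfolding complexes_def
proof (intro CollectI conjI ballI allI impI)
  fix \<sigma> \<tau> assume "\<sigma> \<in> realize N \<omega>" "\<tau> \<noteq> {} \<and> \<tau> \<subseteq> \<sigma>"
  thus "\<tau> \<in> realize N \<omega>" by (simp add: realize_def simplices_def) (meson order_trans)
qed (auto simp: realize_def)

lemma complexesD:
  assumes "\<Delta> \<in> complexes N"
  shows "\<Delta> \<subseteq> simplices N" "\<And>\<sigma> \<tau>. \<sigma> \<in> \<Delta> \<Longrightarrow> \<tau> \<noteq> {} \<Longrightarrow> \<tau> \<subseteq> \<sigma> \<Longrightarrow> \<tau> \<in> \<Delta>"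
  using assms by (auto simp: complexes_def)

lemma subset_realize_iff:
  assumes "K \<in> complexes N"
  shows "K \<subseteq> realize N \<omega> \<longleftrightarrow> K \<subseteq> \<omega>"
proof
  show "K \<subseteq> \<omega>" if "K \<subseteq> realize N \<omega>"
  proof
    fix \<sigma> assume "\<sigma> \<in> K"
    hence "\<sigma> \<in> realize N \<omega>" using that by blast
    thus "\<sigma> \<in> \<omega>" by (simp add: realize_def simplices_def)
  qed
  show "K \<subseteq> realize N \<omega>" if "K \<subseteq> \<omega>"
  proof
    fix \<sigma> assume \<sigma>: "\<sigma> \<in> K"
    have "\<tau> \<in> \<omega>" if "\<tau> \<noteq> {}" "\<tau> \<subseteq> \<sigma>" for \<tau>
      using complexesD(2)[OF assms \<sigma> that] \<open>K \<subseteq> \<omega>\<close> by blast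
    thus "\<sigma> \<in> realize N \<omega>" using complexesD(1)[OF assms] \<sigma> by (auto simp: realize_def)
  qed
qed

text \<open>
  If all coins of \<open>\<Delta>\<close> succeed, a smallest simplex by which the realization exceeds
  \<open>\<Delta>\<close> is a minimal nonface whose coin succeeds. So the event that
  \<open>\<Delta>\<close> is realized fixes the values of some coins and leaves the others free,
  which makes its probability a product.
\<close>

lemma realize_eq_iff:
  assumes \<Delta>: "\<Delta> \<in> complexes N"
  shows "realize N \<omega> = \<Delta> \<longleftrightarrow> \<Delta> \<subseteq> \<omega> \<and> \<omega> \<inter> minimal_nonfaces N \<Delta> = {}"
proof
  assume eq: "realize N \<omega> = \<Delta>"
  have "\<Delta> \<subseteq> \<omega>" using subset_realize_iff[OF \<Delta>, of \<omega>] eq by simp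
  moreover have "\<sigma> \<notin> \<omega>" if \<sigma>: "\<sigma> \<in> minimal_nonfaces N \<Delta>" for \<sigma>
  proof
    assume "\<sigma> \<in> \<omega>"
    have "\<tau> \<in> \<omega>" if "\<tau> \<noteq> {}" "\<tau> \<subseteq> \<sigma>" for \<tau>
      using \<sigma> \<open>\<Delta> \<subseteq> \<omega>\<close> \<open>\<sigma> \<in> \<omega>\<close> that by (cases "\<tau> = \<sigma>") (auto simp: minimal_nonfaces_def)
    hence "\<sigma> \<in> realize N \<omega>"
      using \<sigma> by (simp add: realize_def minimal_nonfaces_def)
    thus False using \<sigma> eq by (simp add: minimal_nonfaces_def)
  qed
  ultimately show "\<Delta> \<subseteq> \<omega> \<and> \<omega> \<inter> minimal_nonfaces N \<Delta> = {}" by auto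
next
  assume \<omega>: "\<Delta> \<subseteq> \<omega> \<and> \<omega> \<inter> minimal_nonfaces N \<Delta> = {}"
  \<comment> \<open>A smallest simplex of the realization outside \<open>\<Delta>\<close> would be a minimal nonface.\<close>
  have "\<sigma> \<in> \<Delta>" if "finite \<sigma>" "\<sigma> \<in> realize N \<omega>" for \<sigma>
    using that
  proof (induction \<sigma> rule: finite_psubset_induct)
    case (psubset \<sigma>)
    have "\<tau> \<in> \<Delta>" if "\<tau> \<noteq> {}" "\<tau> \<subset> \<sigma>" for \<tau>
    proof -
      have "\<tau> \<in> realize N \<omega>"
        using psubset.prems that by (simp add: realize_def simplices_def) (meson order_trans psubset_imp_subset)
      thus ?thesis by (rule psubset.IH[OF that(2)])
    qed
    moreover have "\<sigma> \<in> simplices N" using psubset.prems by (simp add: realize_def)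
    ultimately have "\<sigma> \<notin> \<Delta> \<Longrightarrow> \<sigma> \<in> minimal_nonfaces N \<Delta>" by (simp add: minimal_nonfaces_def)
    moreover have "\<sigma> \<in> \<omega>" using psubset.prems by (simp add: realize_def simplices_def)
    ultimately show ?case using \<omega> by blast
  qed
  moreover have "finite \<sigma>" if "\<sigma> \<in> realize N \<omega>" for \<sigma>
    using that finite_subset by (auto simp: realize_def simplices_def)
  ultimately have "realize N \<omega> \<subseteq> \<Delta>" by blast
  thus "realize N \<omega> = \<Delta>" using subset_realize_iff[OF \<Delta>, of \<omega>] \<omega> by (simp add: subset_antisym)
qed

lemma realization_prob_eq_sum_coin_weight:
  assumes \<Delta>: "\<Delta> \<in> complexes N"
  shows "realization_prob N \<Delta> = (\<Sum>\<omega>\<in>{\<omega> \<in> Pow (simplices N). realize N \<omega> = \<Delta>}. coin_weight (simplices N) Var \<omega>)"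
  unfolding realize_eq_iff[OF \<Delta>] realization_prob_def minimal_nonfaces_def[symmetric]
  using complexesD[OF \<Delta>]
  by (intro sum_coin_weight_cylinder[symmetric] finite_simplices) (auto simp: minimal_nonfaces_def)

text \<open>
  Summing over realizations is summing over all outcomes of the coins, and the realization contains
  \<open>K\<close> exactly on the cylinder where all coins of \<open>K\<close> succeed.
\<close>

lemma sum_realization_prob_containing:
  assumes K: "K \<in> complexes N"
  shows "(\<Sum>\<Delta>\<in>complexes N. of_bool (K \<subseteq> \<Delta>) * realization_prob N \<Delta>) = (\<Prod>\<sigma>\<in>K. Var \<sigma>)"
proof -
  let ?S = "simplices N" and ?w = "coin_weight (simplices N) Var"
  have "(\<Sum>\<Delta>\<in>complexes N. of_bool (K \<subseteq> \<Delta>) * realization_prob N \<Delta>)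
      = (\<Sum>\<Delta>\<in>complexes N. \<Sum>\<omega>\<in>{\<omega> \<in> Pow ?S. realize N \<omega> = \<Delta>}. of_bool (K \<subseteq> realize N \<omega>) * ?w \<omega>)"
    by (intro sum.cong refl) (simp add: realization_prob_eq_sum_coin_weight sum_distrib_left)
  also have "\<dots> = (\<Sum>\<omega>\<in>Pow ?S. of_bool (K \<subseteq> realize N \<omega>) * ?w \<omega>)"
    using realize_in_complexes finite_simplices finite_complexes by (intro sum.group) auto
  also have "\<dots> = (\<Sum>\<omega>\<in>{\<omega> \<in> Pow ?S. K \<subseteq> \<omega> \<and> \<omega> \<inter> {} = {}}. ?w \<omega>)"
    using finite_simplices
    by (intro sum.mono_neutral_cong_right) (auto simp: subset_realize_iff[OF K])
  also have "\<dots> = (\<Prod>\<sigma>\<in>K. Var \<sigma>)"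
    using complexesD(1)[OF K] by (subst sum_coin_weight_cylinder) (auto simp: finite_simplices)
  finally show ?thesis .
qed

text \<open>
  The same cylinder as in the polynomial computation, now measured in the product of the coin
  distributions.
\<close>

lemma pmf_max_random_complex:
  assumes p: "\<forall>\<sigma>\<in>simplices N. 0 \<le> p \<sigma> \<and> p \<sigma> \<le> 1" and \<Delta>: "\<Delta> \<in> complexes N"
  shows "pmf (max_random_complex N p) \<Delta> = poly_eval p (realization_prob N \<Delta>)"
proof -
  let ?S = "simplices N" and ?M = "minimal_nonfaces N \<Delta>"
  let ?B = "\<lambda>\<sigma>. if \<sigma> \<in> \<Delta> then {True} else if \<sigma> \<in> ?M then {False} else UNIV"
  let ?R = "\<lambda>\<omega>. {\<sigma> \<in> ?S. \<forall>\<tau>. \<tau> \<noteq> {} \<and> \<tau> \<subseteq> \<sigma> \<longrightarrow> \<omega> \<tau>}"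
  have \<Delta>S: "\<Delta> \<subseteq> ?S" using complexesD[OF \<Delta>] by simp
  have M: "?M \<subseteq> ?S" "\<Delta> \<inter> ?M = {}" by (auto simp: minimal_nonfaces_def)
  have "?R -` {\<Delta>} = {\<omega>. realize N {\<sigma>. \<omega> \<sigma>} = \<Delta>}" by (auto simp: realize_def)
  also have "\<dots> = {\<omega>. \<Delta> \<subseteq> {\<sigma>. \<omega> \<sigma>} \<and> {\<sigma>. \<omega> \<sigma>} \<inter> ?M = {}}"
    by (simp only: realize_eq_iff[OF \<Delta>])
  also have "\<dots> = Pi ?S ?B"
  proof (rule set_eqI)
    fix \<omega>
    have "\<omega> \<in> Pi ?S ?B \<longleftrightarrow> (\<forall>\<sigma>\<in>?S. (\<sigma> \<in> \<Delta> \<longrightarrow> \<omega> \<sigma>) \<and> (\<sigma> \<in> ?M \<longrightarrow> \<not> \<omega> \<sigma>))"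
      unfolding Pi_iff using M(2) by (intro ball_cong refl) auto
    thus "\<omega> \<in> {\<omega>. \<Delta> \<subseteq> {\<sigma>. \<omega> \<sigma>} \<and> {\<sigma>. \<omega> \<sigma>} \<inter> ?M = {}} \<longleftrightarrow> \<omega> \<in> Pi ?S ?B"
      using \<Delta>S M(1) by blast
  qed
  finally have "pmf (max_random_complex N p) \<Delta>
      = measure_pmf.prob (Pi_pmf ?S False (\<lambda>\<sigma>. bernoulli_pmf (p \<sigma>))) (Pi ?S ?B)"
    by (simp add: max_random_complex_def pmf_map)
  also have "\<dots> = (\<Prod>\<sigma>\<in>?S. measure_pmf.prob (bernoulli_pmf (p \<sigma>)) (?B \<sigma>))"
    by (rule measure_Pi_pmf_Pi[OF finite_simplices])
  also have "\<dots> = (\<Prod>\<sigma>\<in>\<Delta> \<union> ?M. if \<sigma> \<in> \<Delta> then p \<sigma> else 1 - p \<sigma>)"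
  proof (rule prod.mono_neutral_cong_right)
    fix \<sigma> assume \<sigma>: "\<sigma> \<in> \<Delta> \<union> ?M"
    hence "0 \<le> p \<sigma>" "p \<sigma> \<le> 1" using p \<Delta>S M by auto
    thus "measure_pmf.prob (bernoulli_pmf (p \<sigma>)) (?B \<sigma>) = (if \<sigma> \<in> \<Delta> then p \<sigma> else 1 - p \<sigma>)"
      using \<sigma> by (auto simp: measure_pmf_single)
  qed (use \<Delta>S M finite_simplices in auto)
  also have "\<dots> = (\<Prod>\<sigma>\<in>\<Delta>. if \<sigma> \<in> \<Delta> then p \<sigma> else 1 - p \<sigma>) * (\<Prod>\<sigma>\<in>?M. if \<sigma> \<in> \<Delta> then p \<sigma> else 1 - p \<sigma>)"
    using \<Delta>S M finite_subset[OF _ finite_simplices] by (intro prod.union_disjoint) auto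
  also have "\<dots> = (\<Prod>\<sigma>\<in>\<Delta>. p \<sigma>) * (\<Prod>\<sigma>\<in>?M. 1 - p \<sigma>)"
    using M by (intro arg_cong2[of _ _ _ _ "(*)"] prod.cong) auto
  also have "\<dots> = poly_eval p (realization_prob N \<Delta>)"
    by (simp add: realization_prob_def minimal_nonfaces_def poly_eval_mult poly_eval_prod
        poly_eval_diff poly_eval_1 poly_eval_Var)
  finally show ?thesis .
qed

lemma expectation_betti0:
  assumes p: "\<forall>\<sigma>\<in>simplices N. 0 \<le> p \<sigma> \<and> p \<sigma> \<le> 1"
  shows "measure_pmf.expectation (max_random_complex N p) (\<lambda>\<Delta>. real (betti 0 \<Delta>)) =
      poly_eval p (expected_betti0 N)"
proof -
  have "set_pmf (max_random_complex N p) \<subseteq> complexes N"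
    using realize_in_complexes[of N "{\<sigma>. \<omega> \<sigma>}" for \<omega>]
    by (auto simp: max_random_complex_def realize_def)
  hence "measure_pmf.expectation (max_random_complex N p) (\<lambda>\<Delta>. real (betti 0 \<Delta>))
      = (\<Sum>\<Delta>\<in>complexes N. pmf (max_random_complex N p) \<Delta> *\<^sub>R real (betti 0 \<Delta>))"
    by (intro integral_measure_pmf finite_complexes) auto
  also have "\<dots> = poly_eval p (expected_betti0 N)"
    using pmf_max_random_complex[OF p]
    by (simp add: expected_betti0_def poly_eval_sum poly_eval_mult poly_eval_of_nat mult.commute)
  finally show ?thesis .
qed

section \<open>The expansion of the expected Betti number\<close>

definition graph_complex :: "graph \<Rightarrow> nat set set" where
  "graph_complex \<Gamma> = (\<lambda>v. {v}) ` verts \<Gamma> \<union> edges \<Gamma>"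

lemma mon_eq_prod:
  assumes "\<Gamma> \<in> graphs_on A" "finite A"
  shows "mon \<Gamma> = (\<Prod>\<sigma>\<in>graph_complex \<Gamma>. Var \<sigma>)"
proof -
  have fin: "finite (verts \<Gamma>)" using assms finite_subset by (auto simp: graphs_on_def)
  hence "finite (edges \<Gamma>)"
    using assms by (intro finite_subset[of "edges \<Gamma>" "Pow (verts \<Gamma>)"]) (auto simp: graphs_on_def)
  moreover have "(\<lambda>v. {v}) ` verts \<Gamma> \<inter> edges \<Gamma> = {}" using assms by (auto simp: graphs_on_def)
  ultimately show ?thesis
    using fin by (simp add: mon_def graph_complex_def prod.union_disjoint prod.reindex)
qed

lemma edge_faces:
  assumes "card e = 2" "\<tau> \<noteq> {}" "\<tau> \<subseteq> e"
  shows "\<tau> = e \<or> (\<exists>v\<in>e. \<tau> = {v})"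
  using assms by (auto simp: card_2_iff subset_insert_iff split: if_splits)

lemma graph_complex_in_complexes:
  assumes "\<Gamma> \<in> graphs_on {1..N}"
  shows "graph_complex \<Gamma> \<in> complexes N"
  unfolding complexes_def
proof (intro CollectI conjI ballI allI impI)
  have E: "e \<subseteq> verts \<Gamma>" "card e = 2" if "e \<in> edges \<Gamma>" for e
    using that assms by (auto simp: graphs_on_def)
  show "graph_complex \<Gamma> \<subseteq> simplices N"
    using assms E by (fastforce simp: graph_complex_def simplices_def graphs_on_def)
  fix \<sigma> \<tau> assume "\<sigma> \<in> graph_complex \<Gamma>" "\<tau> \<noteq> {} \<and> \<tau> \<subseteq> \<sigma>"
  thus "\<tau> \<in> graph_complex \<Gamma>"
    using edge_faces[OF E(2), of \<sigma> \<tau>] E(1)[of \<sigma>]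
    by (auto simp: graph_complex_def)
qed

text \<open>
  Without isolated vertices, every vertex is a face of an edge, so the edges alone decide containment
  in a complex.
\<close>

lemma graph_complex_subset_iff:
  assumes "no_isolated_verts \<Gamma>" "\<Delta> \<in> complexes N"
  shows "graph_complex \<Gamma> \<subseteq> \<Delta> \<longleftrightarrow> edges \<Gamma> \<subseteq> \<Delta>"
proof
  assume E: "edges \<Gamma> \<subseteq> \<Delta>"
  have "{v} \<in> \<Delta>" if v: "v \<in> verts \<Gamma>" for v
  proof -
    obtain e where "e \<in> edges \<Gamma>" "v \<in> e"
      using assms(1) v unfolding no_isolated_verts_def by blast
    thus ?thesis using complexesD(2)[OF assms(2), of e "{v}"] E by auto
  qed
  thus "graph_complex \<Gamma> \<subseteq> \<Delta>" using E by (auto simp: graph_complex_def)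
qed (auto simp: graph_complex_def)

text \<open>
  Every indicator is written for a complex \<open>K\<close>, not just for its top simplices, so that
  the summation over \<open>\<Delta>\<close> turns it into the full monomial of \<open>K\<close>, including
  the vertex variables.
\<close>

lemma betti_0_expansion:
  assumes \<Delta>: "\<Delta> \<in> complexes N"
  shows "int (betti 0 \<Delta>) =
      (\<Sum>i\<in>{1..N}. of_bool ({{i}} \<subseteq> \<Delta>))
    - (\<Sum>i\<in>{1..N}. \<Sum>j\<in>{i<..N}. of_bool ({{i}, {j}, {i, j}} \<subseteq> \<Delta>))
    + (\<Sum>\<Gamma>\<in>cycle_built_graphs N. c1 \<Gamma> * of_bool (graph_complex \<Gamma> \<subseteq> \<Delta>))"
proof -
  let ?V = "{\<sigma> \<in> \<Delta>. card \<sigma> = 1}" and ?E = "{\<sigma> \<in> \<Delta>. card \<sigma> = 2}"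
  have \<Delta>N: "\<sigma> \<subseteq> {1..N}" if "\<sigma> \<in> \<Delta>" for \<sigma>
    using complexesD(1)[OF \<Delta>] that by (auto simp: simplices_def)
  have fin: "finite \<Delta>" using complexesD(1)[OF \<Delta>] finite_simplices finite_subset by blast
  have "?V = (\<lambda>i. {i}) ` {i \<in> {1..N}. {{i}} \<subseteq> \<Delta>}"
    using \<Delta>N by (fastforce simp: card_1_singleton_iff)
  hence V: "int (card ?V) = (\<Sum>i\<in>{1..N}. of_bool ({{i}} \<subseteq> \<Delta>))"
    by (simp add: card_image sum.If_cases of_bool_def Int_def)
  let ?T = "SIGMA i:{1..N}. {i<..N}"
  have closed: "{{i}, {j}, {i, j}} \<subseteq> \<Delta> \<longleftrightarrow> {i, j} \<in> \<Delta>" for i j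
    using complexesD(2)[OF \<Delta>, of "{i, j}"] by auto
  have "?E = (\<lambda>(i, j). {i, j}) ` {(i, j) \<in> ?T. {i, j} \<in> \<Delta>}"
  proof
    show "?E \<subseteq> (\<lambda>(i, j). {i, j}) ` {(i, j) \<in> ?T. {i, j} \<in> \<Delta>}"
    proof
      fix e assume e: "e \<in> ?E"
      then obtain a b where ab: "a < b" "e = {a, b}" by (auto simp: card2_iff)
      hence "(a, b) \<in> {(i, j) \<in> ?T. {i, j} \<in> \<Delta>}" using e \<Delta>N[of e] by auto
      thus "e \<in> (\<lambda>(i, j). {i, j}) ` {(i, j) \<in> ?T. {i, j} \<in> \<Delta>}" using ab by force
    qed
  qed auto
  moreover have "inj_on (\<lambda>(i, j). {i, j}) {(i, j) \<in> ?T. {i, j} \<in> \<Delta>}"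
    by (auto simp: inj_on_def doubleton_eq_iff)
  ultimately have "int (card ?E) = int (card {(i, j) \<in> ?T. {i, j} \<in> \<Delta>})"
    by (simp add: card_image)
  also have "{(i, j) \<in> ?T. {i, j} \<in> \<Delta>} = ?T \<inter> {t. {fst t, snd t} \<in> \<Delta>}" by auto
  also have "int (card \<dots>) = (\<Sum>t\<in>?T. of_bool ({fst t, snd t} \<in> \<Delta>))"
    by (simp add: of_bool_def sum.If_cases)
  also have "\<dots> = (\<Sum>i\<in>{1..N}. \<Sum>j\<in>{i<..N}. of_bool ({{i}, {j}, {i, j}} \<subseteq> \<Delta>))"
    unfolding closed by (subst sum.Sigma) (simp_all add: case_prod_unfold)
  finally have E: "int (card ?E) = \<dots>" .
  have "int (cycle_rank ?E) = (\<Sum>\<Gamma>\<in>cycle_built_graphs N. if edges \<Gamma> \<subseteq> ?E then c1 \<Gamma> else 0)"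
    using \<Delta>N by (intro cycle_rank_eq_sum_cycle_built) auto
  also have "\<dots> = (\<Sum>\<Gamma>\<in>cycle_built_graphs N. c1 \<Gamma> * of_bool (graph_complex \<Gamma> \<subseteq> \<Delta>))"
  proof (intro sum.cong refl)
    fix \<Gamma> assume \<Gamma>: "\<Gamma> \<in> cycle_built_graphs N"
    hence "edges \<Gamma> \<subseteq> ?E \<longleftrightarrow> edges \<Gamma> \<subseteq> \<Delta>"
      by (auto simp: cycle_built_graphs_def graphs_on_def)
    thus "(if edges \<Gamma> \<subseteq> ?E then c1 \<Gamma> else 0) = c1 \<Gamma> * of_bool (graph_complex \<Gamma> \<subseteq> \<Delta>)"
      using graph_complex_subset_iff[OF _ \<Delta>, of \<Gamma>] \<Gamma> by (auto simp: cycle_built_graphs_def)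
  qed
  finally have R: "int (cycle_rank ?E) = \<dots>" .
  show ?thesis
    using betti_0_eq[OF fin] complexesD(2)[OF \<Delta>] V E R by simp
qed

lemma expected_betti0_expansion:
  "expected_betti0 N =
       (\<Sum>i\<in>{1..N}. Var {i}) -
       (\<Sum>i\<in>{1..N}. \<Sum>j\<in>{i<..N}. Var {i} * Var {j} * Var {i, j}) +
       (\<Sum>\<Gamma>\<in>cycle_built_graphs N. of_int (c1 \<Gamma>) * mon \<Gamma>)"
proof -
  let ?Q = "\<lambda>K. \<Sum>\<Delta>\<in>complexes N. of_bool (K \<subseteq> \<Delta>) * realization_prob N \<Delta>"
  have "expected_betti0 N = (\<Sum>\<Delta>\<in>complexes N. of_int (int (betti 0 \<Delta>)) * realization_prob N \<Delta>)"
    by (simp add: expected_betti0_def)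
  also have "\<dots> = (\<Sum>\<Delta>\<in>complexes N.
        (\<Sum>i\<in>{1..N}. of_bool ({{i}} \<subseteq> \<Delta>) * realization_prob N \<Delta>)
      - (\<Sum>i\<in>{1..N}. \<Sum>j\<in>{i<..N}. of_bool ({{i}, {j}, {i, j}} \<subseteq> \<Delta>) * realization_prob N \<Delta>)
      + (\<Sum>\<Gamma>\<in>cycle_built_graphs N. of_int (c1 \<Gamma>) * (of_bool (graph_complex \<Gamma> \<subseteq> \<Delta>) * realization_prob N \<Delta>)))"
    by (intro sum.cong refl, subst betti_0_expansion)
      (simp_all add: of_int_sum sum_distrib_right ring_distribs mult.assoc)
  also have "\<dots> = (\<Sum>i\<in>{1..N}. ?Q {{i}}) - (\<Sum>i\<in>{1..N}. \<Sum>j\<in>{i<..N}. ?Q {{i}, {j}, {i, j}})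
      + (\<Sum>\<Gamma>\<in>cycle_built_graphs N. of_int (c1 \<Gamma>) * ?Q (graph_complex \<Gamma>))"
    by (simp only: sum.distrib sum_subtractf sum_distrib_left sum.swap[of _ _ "complexes N"])
  also have "(\<Sum>i\<in>{1..N}. ?Q {{i}}) = (\<Sum>i\<in>{1..N}. Var {i})"
  proof (intro sum.cong refl)
    fix i assume "i \<in> {1..N}"
    hence "{{i}} \<in> complexes N" by (auto simp: complexes_def simplices_def)
    thus "?Q {{i}} = Var {i}" by (simp add: sum_realization_prob_containing del: insert_subset)
  qed
  also have "(\<Sum>i\<in>{1..N}. \<Sum>j\<in>{i<..N}. ?Q {{i}, {j}, {i, j}})
      = (\<Sum>i\<in>{1..N}. \<Sum>j\<in>{i<..N}. Var {i} * Var {j} * Var {i, j})"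
  proof (intro sum.cong refl)
    fix i j assume ij: "i \<in> {1..N}" "j \<in> {i<..N}"
    hence "({i, j}, {{i, j}}) \<in> graphs_on {1..N}" by (auto simp: graphs_on_def)
    from graph_complex_in_complexes[OF this] have "{{i}, {j}, {i, j}} \<in> complexes N"
      by (simp add: graph_complex_def insert_commute)
    moreover have "{i} \<noteq> {j}" "{i} \<noteq> {i, j}" "{j} \<noteq> {i, j}" using ij by auto
    ultimately show "?Q {{i}, {j}, {i, j}} = Var {i} * Var {j} * Var {i, j}"
      by (simp add: sum_realization_prob_containing mult.assoc del: insert_subset)
  qed
  also have "(\<Sum>\<Gamma>\<in>cycle_built_graphs N. of_int (c1 \<Gamma>) * ?Q (graph_complex \<Gamma>))
      = (\<Sum>\<Gamma>\<in>cycle_built_graphs N. of_int (c1 \<Gamma>) * mon \<Gamma>)"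
  proof (intro sum.cong refl)
    fix \<Gamma> assume "\<Gamma> \<in> cycle_built_graphs N"
    hence "\<Gamma> \<in> graphs_on {1..N}" by (simp add: cycle_built_graphs_def)
    thus "of_int (c1 \<Gamma>) * ?Q (graph_complex \<Gamma>) = of_int (c1 \<Gamma>) * mon \<Gamma>"
      by (simp add: sum_realization_prob_containing graph_complex_in_complexes mon_eq_prod[where A = "{1..N}"])
  qed
  finally show ?thesis .
qed

lemma prod_Var: "(\<Prod>\<sigma>\<in>K. Var \<sigma>) = Poly_Mapping.single (\<Sum>\<sigma>\<in>K. Poly_Mapping.single \<sigma> 1) 1"
  by (induction K rule: infinite_finite_induct) (auto simp: Var_def mult_single)

text \<open>
  A scalar multiple of a monomial has at most one nonzero coefficient.
\<close>

lemma lookup_monomial_eq_0: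
  assumes "Poly_Mapping.single m 1 \<noteq> P" "P = Poly_Mapping.single m' 1"
  shows "Poly_Mapping.lookup (of_int c * P) m = 0"
proof -
  have "of_int c * P = Poly_Mapping.single m' (of_int c)"
    using assms(2) mult_single[of 0 "of_int c" m' 1] by simp
  moreover have "m \<noteq> m'" using assms by auto
  ultimately show ?thesis by (simp add: lookup_single)
qed

theorem theorem3:
  fixes N :: nat
  shows
    "(\<forall>p. (\<forall>\<sigma>\<in>simplices N. 0 \<le> p \<sigma> \<and> p \<sigma> \<le> 1) \<longrightarrow>
        measure_pmf.expectation (max_random_complex N p) (\<lambda>\<Delta>. real (betti 0 \<Delta>)) =
          poly_eval p (expected_betti0 N)) \<and>
     expected_betti0 N =
       (\<Sum>i\<in>{1..N}. Var {i}) -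
       (\<Sum>i\<in>{1..N}. \<Sum>j\<in>{i<..N}. Var {i} * Var {j} * Var {i, j}) +
       (\<Sum>\<Gamma>\<in>cycle_built_graphs N. of_int (c1 \<Gamma>) * mon \<Gamma>) \<and>
     (\<forall>\<Gamma>\<in>graphs_on {1..N}.
        (\<Sum>i=0..card (edges \<Gamma>). \<Sum>\<Gamma>'\<in>edge_removals \<Gamma> i. c1 \<Gamma>') = int (betti1_graph \<Gamma>)) \<and>
     (\<forall>m. Poly_Mapping.single m 1 \<notin>
           {Var {i} |i. i \<in> {1..N}} \<union>
           {Var {i} * Var {j} * Var {i, j} |i j. 1 \<le> i \<and> i < j \<and> j \<le> N} \<union>
           mon ` cycle_built_graphs N \<longrightarrow>
         Poly_Mapping.lookup (expected_betti0 N) m = 0)"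
proof (intro conjI allI impI ballI)
  show "expected_betti0 N =
       (\<Sum>i\<in>{1..N}. Var {i}) -
       (\<Sum>i\<in>{1..N}. \<Sum>j\<in>{i<..N}. Var {i} * Var {j} * Var {i, j}) +
       (\<Sum>\<Gamma>\<in>cycle_built_graphs N. of_int (c1 \<Gamma>) * mon \<Gamma>)"
    by (rule expected_betti0_expansion)
next
  fix m :: "nat set \<Rightarrow>\<^sub>0 nat"
  assume m: "Poly_Mapping.single m 1 \<notin>
           {Var {i} |i. i \<in> {1..N}} \<union>
           {Var {i} * Var {j} * Var {i, j} |i j. 1 \<le> i \<and> i < j \<and> j \<le> N} \<union>
           mon ` cycle_built_graphs N"
  have "Poly_Mapping.lookup (Var {i}) m = 0" if "i \<in> {1..N}" for i
    using lookup_monomial_eq_0[of m "Var {i}" _ 1] m that by (auto simp: Var_def)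
  moreover have "Poly_Mapping.lookup (Var {i} * Var {j} * Var {i, j}) m = 0"
    if "i \<in> {1..N}" "j \<in> {i<..N}" for i j
  proof -
    have "Poly_Mapping.single m 1 \<noteq> Var {i} * Var {j} * Var {i, j}" using m that by auto
    thus ?thesis
      using lookup_monomial_eq_0[of m "Var {i} * Var {j} * Var {i, j}" _ 1]
      by (simp add: Var_def mult_single)
  qed
  moreover have "Poly_Mapping.lookup (of_int (c1 \<Gamma>) * mon \<Gamma>) m = 0" if "\<Gamma> \<in> cycle_built_graphs N" for \<Gamma>
  proof (rule lookup_monomial_eq_0)
    show "Poly_Mapping.single m 1 \<noteq> mon \<Gamma>" using m that by auto
    show "mon \<Gamma> = Poly_Mapping.single (\<Sum>\<sigma>\<in>graph_complex \<Gamma>. Poly_Mapping.single \<sigma> 1) 1"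
      using that mon_eq_prod[of \<Gamma> "{1..N}"] by (simp add: cycle_built_graphs_def prod_Var)
  qed
  ultimately show "Poly_Mapping.lookup (expected_betti0 N) m = 0"
    by (simp add: expected_betti0_expansion lookup_add lookup_minus lookup_sum)
qed (auto simp: expectation_betti0 sum_c1_edge_removals[where A = "{1..N}"])

end
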